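(* For all $z\in\mathbb{C}\setminus\mathbb{R}$, the function $b(z)=\det(I+\alpha T(z))$ is expanded into the product $$b(z)=b_1(z)\cdots b_n(z),\qquad b_k(z)=1+\alpha_k\langle R_{k-1}(z)v_k,v_k\rangle\quad(1\le k\le n),$$ where $R_k(z)=(L_k-zI)^{-1}$ is the resolvent of the operator $L_k$ $(0\le k\le n)$.
   Context: Let $n\in\mathbb{N}$, let $\alpha_1,\dots,\alpha_n$ be non-zero real numbers, $\alpha=\operatorname{diag}(\alpha_1,\dots,\alpha_n)$, and let $v_1,\dots,v_n$ be linearly independent complex-valued functions on $\mathbb{R}_+=(0,\infty)$ with $\int_{\mathbb{R}_+}(1+x^2)|v_k(x)|^2dx<\infty$ for all $k$. $\langle f,g\rangle=\int_{\mathbb{R}_+}f\overline g\,dx$ is the inner product of $L^2(\mathbb{R}_+)$. $L_0y=-y''$ in $L^2(\mathbb{R}_+)$ with domain $\{y\in W_2^2(\mathbb{R}_+):y(0)=0\}$, and $L_k=L_0+\sum_{s=1}^k\alpha_s\langle\cdot,v_s\rangle v_s$ ($0\le k\le n$) are self-adjoint operators. $T(z)$ is the $n\times n$ matrix whose entry in row $s$, column $k$ is $\langle R_0(z)v_k,v_s\rangle$, with $R_0(z)=(L_0-zI)^{-1}$. *)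

theory Defs
  imports "HOL-Analysis.Analysis" "Jordan_Normal_Form.Determinant"
begin

text \<open>
  Elements of \<open>L\<^sup>2(\<real>\<^sub>+)\<close> are represented by functions on the reals of which only the values on
  \<open>(0, \<infinity>)\<close> matter; representatives that agree almost everywhere are identified by using almost
  everywhere equality in all definitions.
\<close>

abbreviation pos_measure :: "real measure" where
  "pos_measure \<equiv> lebesgue_on {0<..}"

definition L2_pos :: "(real \<Rightarrow> complex) set" where
  "L2_pos = {f \<in> borel_measurable pos_measure. integrable pos_measure (\<lambda>x. (cmod (f x))\<^sup>2)}"

definition L2_inner :: "(real \<Rightarrow> complex) \<Rightarrow> (real \<Rightarrow> complex) \<Rightarrow> complex" where
  "L2_inner f g = (\<integral>x. f x * cnj (g x) \<partial>pos_measure)"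

definition L2_independent :: "nat \<Rightarrow> (nat \<Rightarrow> real \<Rightarrow> complex) \<Rightarrow> bool" where
  "L2_independent n v \<longleftrightarrow>
     (\<forall>c :: nat \<Rightarrow> complex. (AE x in pos_measure. (\<Sum>k=1..n. c k * v k x) = 0)
        \<longrightarrow> (\<forall>k\<in>{1..n}. c k = 0))"

text \<open>
  \<open>f\<close> is absolutely continuous on every \<open>[0, x]\<close> with almost everywhere derivative \<open>g\<close>, that is,
  \<open>f\<close> is an indefinite Lebesgue integral of \<open>g\<close>. The value \<open>f 0\<close> is the limit of \<open>f\<close> at \<open>0\<close>.
\<close>

definition ac_with_deriv :: "(real \<Rightarrow> complex) \<Rightarrow> (real \<Rightarrow> complex) \<Rightarrow> bool" where
  "ac_with_deriv f g \<longleftrightarrow>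
     (\<forall>x\<ge>0. set_integrable lebesgue {0<..x} g \<and> f x = f 0 + (LINT t:{0<..x}|lebesgue. g t))"

text \<open>
  \<open>u\<close> is the continuous representative of an element of the Sobolev space \<open>W\<^sub>2\<^sup>2(\<real>\<^sub>+)\<close> (two
  derivatives, all in \<open>L\<^sup>2\<close>), with derivatives \<open>u1\<close> and \<open>u2\<close>.
\<close>

definition W22_with_derivs ::
    "(real \<Rightarrow> complex) \<Rightarrow> (real \<Rightarrow> complex) \<Rightarrow> (real \<Rightarrow> complex) \<Rightarrow> bool" where
  "W22_with_derivs u u1 u2 \<longleftrightarrow>
     u \<in> L2_pos \<and> u1 \<in> L2_pos \<and> u2 \<in> L2_pos \<and> ac_with_deriv u u1 \<and> ac_with_deriv u1 u2"

text \<open>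
  Unbounded operators are given by their graphs: \<open>(y, f) \<in> A\<close> means that \<open>y\<close> is in the domain and
  \<open>A y = f\<close>. The graphs are saturated under almost everywhere equality in both components.
\<close>

definition L_free :: "((real \<Rightarrow> complex) \<times> (real \<Rightarrow> complex)) set" where
  "L_free = {(y, f). y \<in> L2_pos \<and> f \<in> L2_pos \<and>
     (\<exists>u u1 u2. W22_with_derivs u u1 u2 \<and> u 0 = 0 \<and>
        (AE x in pos_measure. y x = u x) \<and> (AE x in pos_measure. f x = - u2 x))}"

definition L_pert :: "(nat \<Rightarrow> real) \<Rightarrow> (nat \<Rightarrow> real \<Rightarrow> complex) \<Rightarrow> nat
    \<Rightarrow> ((real \<Rightarrow> complex) \<times> (real \<Rightarrow> complex)) set" where
  "L_pert \<alpha> v k = {(y, g). g \<in> L2_pos \<and>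
     (\<exists>f. (y, f) \<in> L_free \<and>
        (AE x in pos_measure. g x =
           f x + (\<Sum>s=1..k. complex_of_real (\<alpha> s) * L2_inner y (v s) * v s x)))}"

text \<open>
  \<open>resolvent A z f\<close> is a representative of \<open>(A - z I)\<^sup>-\<^sup>1 f\<close>; for \<open>z\<close> in the resolvent set of \<open>A\<close>
  and \<open>f \<in> L\<^sup>2\<close> it exists and is determined up to a null set.
\<close>

definition resolvent :: "((real \<Rightarrow> complex) \<times> (real \<Rightarrow> complex)) set \<Rightarrow> complex
    \<Rightarrow> (real \<Rightarrow> complex) \<Rightarrow> (real \<Rightarrow> complex)" where
  "resolvent A z f =
     (SOME y. \<exists>g. (y, g) \<in> A \<and> (AE x in pos_measure. g x - z * y x = f x))"

text \<open>Matrix indices start at \<open>0\<close>, whereas the families \<open>\<alpha>\<close> and \<open>v\<close> are indexed by \<open>1, \<dots>, n\<close>.\<close>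

definition alpha_mat :: "nat \<Rightarrow> (nat \<Rightarrow> real) \<Rightarrow> complex mat" where
  "alpha_mat n \<alpha> = mat_diag n (\<lambda>i. complex_of_real (\<alpha> (Suc i)))"

definition T_mat :: "nat \<Rightarrow> (nat \<Rightarrow> real \<Rightarrow> complex) \<Rightarrow> complex \<Rightarrow> complex mat" where
  "T_mat n v z =
     Matrix.mat n n (\<lambda>(s, k). L2_inner (resolvent L_free z (v (Suc k))) (v (Suc s)))"

definition b_det :: "nat \<Rightarrow> (nat \<Rightarrow> real) \<Rightarrow> (nat \<Rightarrow> real \<Rightarrow> complex) \<Rightarrow> complex \<Rightarrow> complex" where
  "b_det n \<alpha> v z = Determinant.det (1\<^sub>m n + alpha_mat n \<alpha> * T_mat n v z)"

definition b_factor :: "(nat \<Rightarrow> real) \<Rightarrow> (nat \<Rightarrow> real \<Rightarrow> complex) \<Rightarrow> nat \<Rightarrow> complex \<Rightarrow> complex" where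
  "b_factor \<alpha> v k z =
     1 + complex_of_real (\<alpha> k) * L2_inner (resolvent (L_pert \<alpha> v (k - 1)) z (v k)) (v k)"

end

theory Submission
  imports Defs
begin

text \<open>
  Put \<open>w = R\<^bsub>k-1\<^esub>(z) v\<^sub>k\<close>. The second resolvent identity
  \<open>R\<^sub>0(z) v\<^sub>k = w + \<Sum>\<^bsub>s<k\<^esub> \<alpha>\<^sub>s \<langle>w, v\<^sub>s\<rangle> R\<^sub>0(z) v\<^sub>s\<close>, paired with \<open>v\<^sub>1, \<dots>, v\<^sub>k\<close>, says that the last column
  of the leading \<open>k \<times> k\<close> block of \<open>I + \<alpha> T(z)\<close> is \<open>b\<^sub>k(z) e\<^sub>k\<close> plus a linear combination of the other
  columns, so each leading principal minor is \<open>b\<^sub>k(z)\<close> times the preceding one.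

  The identity needs the resolvents to exist and to be unique. Uniqueness follows from the
  symmetry of \<open>L\<^sub>k\<close>, an integration by parts. For existence, with \<open>z = -\<kappa>\<^sup>2\<close> and \<open>Re \<kappa> > 0\<close>, the
  equation \<open>-y'' - z y = f\<close> splits into the first-order equations \<open>p' = -\<kappa> p + f\<close> and
  \<open>q' = \<kappa> q - f\<close>, whose bounded solutions are in \<open>L\<^sup>2\<close> by an energy estimate. A rank-one perturbation
  preserves solvability, because a zero of \<open>b\<^sub>k\<close> would be an eigenvalue of \<open>L\<^sub>k\<close>.
\<close>

subsection \<open>Absolutely continuous functions\<close>

lemma set_integrable_lebesgue_on_iff:
  fixes g :: "real \<Rightarrow> complex"
  shows "set_integrable lebesgue {0<..x} g \<longleftrightarrow> integrable (lebesgue_on {0<..x}) g"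
  by (simp add: set_integrable_def integrable_restrict_space)

lemma set_integral_lebesgue_on:
  fixes g :: "real \<Rightarrow> complex"
  shows "(LINT t:{0<..x}|lebesgue. g t) = integral\<^sup>L (lebesgue_on {0<..x}) g"
  by (simp add: set_lebesgue_integral_def integral_restrict_space)

lemma ac_with_deriv_iff:
  "ac_with_deriv f g \<longleftrightarrow> (\<forall>x\<ge>0. integrable (lebesgue_on {0<..x}) g \<and>
     integral\<^sup>L (lebesgue_on {0<..x}) g = f x - f 0)"
proof -
  have "a = b + c \<longleftrightarrow> c = a - b" for a b c :: complex
    by (auto simp: algebra_simps)
  then show ?thesis
    unfolding ac_with_deriv_def set_integrable_lebesgue_on_iff set_integral_lebesgue_on by simp
qed

lemma ac_with_deriv_integrable:
  "ac_with_deriv f g \<Longrightarrow> 0 \<le> x \<Longrightarrow> integrable (lebesgue_on {0<..x}) g"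
  by (simp add: ac_with_deriv_iff)

lemma ac_with_deriv_integral:
  "ac_with_deriv f g \<Longrightarrow> 0 \<le> x \<Longrightarrow> integral\<^sup>L (lebesgue_on {0<..x}) g = f x - f 0"
  by (simp add: ac_with_deriv_iff)

lemma borel_measurable_ident_lebesgue_on [measurable]:
  "(\<lambda>x::real. x) \<in> borel_measurable (lebesgue_on S)"
  by (intro measurable_restrict_space1 measurable_completion) simp

lemma AE_lebesgue_on_neq:
  fixes c :: real
  assumes "S \<in> sets lebesgue"
  shows "AE x in lebesgue_on S. x \<noteq> c"
proof -
  have "AE x in lebesgue. x \<noteq> c"
    using AE_lborel_singleton[of c] by (rule AE_completion)
  then show ?thesis
    by (subst AE_restrict_space_iff) (use assms in \<open>auto intro: eventually_mono\<close>)
qed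

text \<open>
  Fubini for \<open>f' s * g' t\<close> on the two triangles of the square \<open>(0, x] \<times> (0, x]\<close>.
\<close>

lemma ac_with_deriv_mult_integral:
  assumes F: "ac_with_deriv f f'" and G: "ac_with_deriv g g'" and x: "0 \<le> x"
  shows "integrable (lebesgue_on {0<..x}) (\<lambda>t. f t * g' t)" (is ?A)
    and "(LINT t|lebesgue_on {0<..x}. f' t * g t + f t * g' t) = f x * g x - f 0 * g 0" (is ?B)
proof -
  define M where "M = lebesgue_on {0<..x}"
  have space_M: "space M = {0<..x}" by (simp add: M_def)
  have fin: "finite_measure M"
    unfolding M_def by (intro finite_measure_lebesgue_on bounded_set_imp_lmeasurable) auto
  interpret finite_measure M by (rule fin)
  interpret pair_sigma_finite M M ..
  have iF: "integrable M f'" and iG: "integrable M g'"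
    using F G x by (auto intro: ac_with_deriv_integrable simp: M_def)
  note [measurable] = borel_measurable_integrable[OF iF] borel_measurable_integrable[OF iG]
  have id_M [measurable]: "(\<lambda>x. x) \<in> borel_measurable M"
    by (simp add: M_def)
  have restr: "(LINT s|M. (if s \<le> t then h s else 0)) = integral\<^sup>L (lebesgue_on {0<..t}) h"
    if "t \<in> space M" for t and h :: "real \<Rightarrow> complex"
  proof -
    have "(LINT s|M. (if s \<le> t then h s else 0)) = (LINT s|M. (if s \<in> {0<..t} then h s else 0))"
      by (intro Bochner_Integration.integral_cong) (auto simp: space_M)
    also have "\<dots> = integral\<^sup>L (lebesgue_on {0<..t}) h"
      unfolding M_def
    proof (rule integral_restrict)
      show "{0<..t} \<subseteq> {0<..x}" using that by (auto simp: space_M)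
    qed simp_all
    finally show ?thesis .
  qed
  have valF: "(LINT s|M. (if s \<le> t then f' s else 0)) = f t - f 0" if "t \<in> space M" for t
    using restr[OF that, of f'] F that by (simp add: ac_with_deriv_integral space_M)
  have valG: "(LINT s|M. (if s \<le> t then g' s else 0)) = g t - g 0" if "t \<in> space M" for t
    using restr[OF that, of g'] G that by (simp add: ac_with_deriv_integral space_M)
  have totF: "integral\<^sup>L M f' = f x - f 0" and totG: "integral\<^sup>L M g' = g x - g 0"
    using F G x by (auto simp: ac_with_deriv_integral M_def)
  have valG': "(LINT t|M. (if t < s then g' t else 0)) = g s - g 0" if "s \<in> space M" for s
  proof -
    \<comment> \<open>The two triangles must be disjoint, so this one is taken without the diagonal;
      the single point t = s is a null set.\<close>
    have "AE t in M. t \<noteq> s"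
      unfolding M_def by (rule AE_lebesgue_on_neq) simp
    then have "(LINT t|M. (if t < s then g' t else 0)) = (LINT t|M. (if t \<le> s then g' t else 0))"
      by (intro integral_cong_AE) (auto elim!: AE_mp)
    then show ?thesis using valG[OF that] by simp
  qed
  have iP: "integrable (M \<Otimes>\<^sub>M M) (\<lambda>(s, t). f' s * g' t)"
  proof (rule Fubini_integrable)
    show "integrable M (\<lambda>s. LINT t|M. norm (case (s, t) of (s, t) \<Rightarrow> f' s * g' t))"
      using iF by (simp add: norm_mult)
    show "AE s in M. integrable M (\<lambda>t. case (s, t) of (s, t) \<Rightarrow> f' s * g' t)"
      using iG by simp
  qed measurable
  have i1: "integrable (M \<Otimes>\<^sub>M M) (\<lambda>(s, t). if s \<le> t then f' s * g' t else 0)"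
    by (rule Bochner_Integration.integrable_bound[OF iP]) (measurable, auto)
  have i2: "integrable (M \<Otimes>\<^sub>M M) (\<lambda>(s, t). if t < s then f' s * g' t else 0)"
    by (rule Bochner_Integration.integrable_bound[OF iP]) (measurable, auto)
  have inner1: "(LINT s|M. (if s \<le> t then f' s * g' t else 0)) = (f t - f 0) * g' t"
    if "t \<in> space M" for t
  proof -
    have "(LINT s|M. (if s \<le> t then f' s * g' t else 0))
        = (LINT s|M. (if s \<le> t then f' s else 0) * g' t)"
      by (intro Bochner_Integration.integral_cong) auto
    then show ?thesis by (simp add: valF[OF that])
  qed
  have inner2: "(LINT t|M. (if t < s then f' s * g' t else 0)) = f' s * (g s - g 0)"
    if "s \<in> space M" for s
  proof -
    have "(LINT t|M. (if t < s then f' s * g' t else 0))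
        = (LINT t|M. f' s * (if t < s then g' t else 0))"
      by (intro Bochner_Integration.integral_cong) auto
    then show ?thesis by (simp add: valG'[OF that])
  qed
  \<comment> \<open>Fubini itself yields the integrability of these inner integrals, so
    measurability of \<open>f\<close> and \<open>g\<close> need not be shown first.\<close>
  have J1: "integrable M (\<lambda>t. (f t - f 0) * g' t)"
    using integrable_snd[OF i1] inner1 by (simp cong: Bochner_Integration.integrable_cong)
  have J2: "integrable M (\<lambda>s. f' s * (g s - g 0))"
    using integrable_fst[OF i2] inner2 by (simp cong: Bochner_Integration.integrable_cong)
  have e1: "(LINT t|M. (f t - f 0) * g' t)
      = (LINT (s, t)|(M \<Otimes>\<^sub>M M). (if s \<le> t then f' s * g' t else 0))"
    unfolding integral_snd[OF i1, symmetric]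
    by (intro Bochner_Integration.integral_cong) (auto simp: inner1)
  have e2: "(LINT s|M. f' s * (g s - g 0))
      = (LINT (s, t)|(M \<Otimes>\<^sub>M M). (if t < s then f' s * g' t else 0))"
    unfolding integral_fst[OF i2, symmetric]
    by (intro Bochner_Integration.integral_cong) (auto simp: inner2)
  have "(LINT t|M. (f t - f 0) * g' t) + (LINT s|M. f' s * (g s - g 0))
      = (LINT p|(M \<Otimes>\<^sub>M M). (case p of (s, t) \<Rightarrow> if s \<le> t then f' s * g' t else 0)
          + (case p of (s, t) \<Rightarrow> if t < s then f' s * g' t else 0))"
    unfolding e1 e2 by (rule Bochner_Integration.integral_add[OF i1 i2, symmetric])
  also have "\<dots> = (LINT (s, t)|(M \<Otimes>\<^sub>M M). f' s * g' t)"
    by (intro Bochner_Integration.integral_cong) auto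
  also have "\<dots> = (LINT s|M. LINT t|M. f' s * g' t)"
    by (rule integral_fst[OF iP, symmetric])
  also have "\<dots> = (f x - f 0) * (g x - g 0)"
    by (simp add: totF totG)
  finally have sum: "(LINT t|M. (f t - f 0) * g' t) + (LINT s|M. f' s * (g s - g 0))
      = (f x - f 0) * (g x - g 0)" .
  \<comment> \<open>The two triangles see only the increments \<open>f t - f 0\<close> and
    \<open>g t - g 0\<close>; the constants \<open>f 0\<close> and \<open>g 0\<close> are put back
    here.\<close>
  have split: "f' t * g t + f t * g' t
      = ((f t - f 0) * g' t + f' t * (g t - g 0)) + (f 0 * g' t + f' t * g 0)" for t
    by (simp add: algebra_simps)
  have "integrable M (\<lambda>t. (f t - f 0) * g' t + f 0 * g' t)"
    using J1 iG by (intro Bochner_Integration.integrable_add) auto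
  then show ?A by (simp add: algebra_simps M_def)
  have "(LINT t|M. f' t * g t + f t * g' t)
      = (LINT t|M. ((f t - f 0) * g' t + f' t * (g t - g 0)) + (f 0 * g' t + f' t * g 0))"
    by (simp only: split)
  also have "\<dots> = ((LINT t|M. (f t - f 0) * g' t) + (LINT s|M. f' s * (g s - g 0)))
      + (f 0 * integral\<^sup>L M g' + integral\<^sup>L M f' * g 0)"
    using J1 J2 iF iG by simp
  also have "\<dots> = f x * g x - f 0 * g 0"
    unfolding sum totF totG by (simp add: algebra_simps)
  finally show ?B
    by (simp add: M_def)
qed

lemma ac_with_deriv_mult:
  assumes F: "ac_with_deriv f f'" and G: "ac_with_deriv g g'"
  shows "ac_with_deriv (\<lambda>x. f x * g x) (\<lambda>x. f' x * g x + f x * g' x)"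
  unfolding ac_with_deriv_iff
proof (intro allI impI conjI)
  fix x :: real
  assume x: "0 \<le> x"
  have "integrable (lebesgue_on {0<..x}) (\<lambda>t. f' t * g t)"
    using ac_with_deriv_mult_integral(1)[OF G F x] by (simp add: mult.commute)
  then show "integrable (lebesgue_on {0<..x}) (\<lambda>x. f' x * g x + f x * g' x)"
    using ac_with_deriv_mult_integral(1)[OF F G x] by (rule Bochner_Integration.integrable_add)
qed (rule ac_with_deriv_mult_integral(2)[OF F G])

lemma ac_with_deriv_add:
  "ac_with_deriv f f' \<Longrightarrow> ac_with_deriv g g' \<Longrightarrow> ac_with_deriv (\<lambda>x. f x + g x) (\<lambda>x. f' x + g' x)"
  by (simp add: ac_with_deriv_iff)

lemma ac_with_deriv_cmult:
  "ac_with_deriv f f' \<Longrightarrow> ac_with_deriv (\<lambda>x. c * f x) (\<lambda>x. c * f' x)"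
  by (simp add: ac_with_deriv_iff right_diff_distrib)

lemma ac_with_deriv_cnj:
  "ac_with_deriv f f' \<Longrightarrow> ac_with_deriv (\<lambda>x. cnj (f x)) (\<lambda>x. cnj (f' x))"
  by (simp add: ac_with_deriv_iff)

lemma ac_with_deriv_const: "ac_with_deriv (\<lambda>x. c) (\<lambda>x. 0)"
  by (simp add: ac_with_deriv_iff)

lemma ac_with_deriv_cong:
  "ac_with_deriv f f' \<Longrightarrow> f = g \<Longrightarrow> f' = g' \<Longrightarrow> ac_with_deriv g g'"
  by simp

lemma ac_with_deriv_indefinite:
  assumes "\<And>x. 0 \<le> x \<Longrightarrow> integrable (lebesgue_on {0<..x}) g"
  shows "ac_with_deriv (\<lambda>x. integral\<^sup>L (lebesgue_on {0<..x}) g) g"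
  using assms by (simp add: ac_with_deriv_iff)

lemma ac_with_deriv_exp:
  "ac_with_deriv (\<lambda>x. exp (c * complex_of_real x)) (\<lambda>x. c * exp (c * complex_of_real x))"
  unfolding ac_with_deriv_iff
proof (intro allI impI conjI)
  fix x :: real
  assume x: "0 \<le> x"
  let ?h = "\<lambda>x. c * exp (c * complex_of_real x)"
  have "?h absolutely_integrable_on {0..x}"
    by (intro absolutely_integrable_continuous_real continuous_intros)
  then have "?h absolutely_integrable_on {0<..x}"
    by (rule set_integrable_subset) auto
  then show i: "integrable (lebesgue_on {0<..x}) ?h"
    by (simp add: set_integrable_lebesgue_on_iff)
  have "(?h has_integral exp (c * complex_of_real x) - exp (c * complex_of_real 0)) {0..x}"
  proof (rule fundamental_theorem_of_calculus[OF x])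
    fix t
    show "((\<lambda>x. exp (c * complex_of_real x)) has_vector_derivative ?h t) (at t within {0..x})"
      by (auto intro!: derivative_eq_intros has_vector_derivative_real_field)
  qed
  then have "(?h has_integral exp (c * complex_of_real x) - exp (c * complex_of_real 0)) {0<..x}"
    by (rule has_integral_spike_set_eq[THEN iffD1, rotated 2])
      (auto intro: negligible_subset[of "{0}"])
  then show "integral\<^sup>L (lebesgue_on {0<..x}) ?h
      = exp (c * complex_of_real x) - exp (c * complex_of_real 0)"
    using has_integral_unique has_integral_integral_lebesgue_on[OF i] by auto
qed

section \<open>Truncation to initial intervals and behaviour at infinity\<close>

lemma integrable_lebesgue_on_mono:
  fixes h :: "'a :: euclidean_space \<Rightarrow> 'b :: {banach, second_countable_topology}"
  assumes "integrable (lebesgue_on T) h" "S \<subseteq> T" "S \<in> sets lebesgue" "T \<in> sets lebesgue"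
  shows "integrable (lebesgue_on S) h"
  using set_integrable_subset[of lebesgue T h S] assms
  by (simp add: set_integrable_def integrable_restrict_space)

lemma integrable_lebesgue_on_initial:
  fixes h :: "real \<Rightarrow> 'a :: {banach, second_countable_topology}"
  shows "integrable pos_measure h \<Longrightarrow> integrable (lebesgue_on {0<..x}) h"
  by (rule integrable_lebesgue_on_mono[of "{0<..}"]) auto

lemma integral_lebesgue_on_initial:
  fixes h :: "real \<Rightarrow> 'a :: {banach, second_countable_topology}"
  shows "(LINT t|pos_measure. (if t \<le> x then h t else 0)) = integral\<^sup>L (lebesgue_on {0<..x}) h"
proof -
  have "indicator {0<..} t *\<^sub>R (if t \<le> x then h t else 0) = indicator {0<..x} t *\<^sub>R h t" for t
    by (auto simp: indicator_def)
  then show ?thesis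
    by (simp add: integral_restrict_space)
qed

lemma integrable_lebesgue_on_initial_iff:
  fixes h :: "real \<Rightarrow> 'a :: {banach, second_countable_topology}"
  shows "integrable pos_measure (\<lambda>t. if t \<le> x then h t else 0) \<longleftrightarrow>
    integrable (lebesgue_on {0<..x}) h"
proof -
  have "indicator {0<..} t *\<^sub>R (if t \<le> x then h t else 0) = indicator {0<..x} t *\<^sub>R h t" for t
    by (auto simp: indicator_def)
  then show ?thesis
    by (simp add: integrable_restrict_space)
qed

text \<open>The truncations of \<open>h\<close> at \<open>n\<close> are measurable on the half-line,
  and they agree with \<open>h\<close> at \<open>t\<close> as soon as n >= t.\<close>

lemma borel_measurable_pos_local:
  fixes h :: "real \<Rightarrow> complex"
  assumes "\<And>x. 0 \<le> x \<Longrightarrow> integrable (lebesgue_on {0<..x}) h"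
  shows "h \<in> borel_measurable pos_measure"
proof (rule borel_measurable_LIMSEQ_metric)
  show "(\<lambda>t. if t \<le> real n then h t else 0) \<in> borel_measurable pos_measure" for n
    using assms[of "real n"] by (simp add: integrable_lebesgue_on_initial_iff[symmetric]
      borel_measurable_integrable)
  show "(\<lambda>n. if t \<le> real n then h t else 0) \<longlonglongrightarrow> h t" for t
    by (rule tendsto_eventually)
      (rule eventually_mono[OF eventually_ge_at_top[of "nat \<lceil>t\<rceil>"]], auto)
qed

text \<open>Monotone convergence: the truncations increase to \<open>h\<close>, and their integrals
  stay below \<open>K\<close>.\<close>

lemma integrable_pos_bounded_local:
  fixes h :: "real \<Rightarrow> real"
  assumes int: "\<And>x. 0 \<le> x \<Longrightarrow> integrable (lebesgue_on {0<..x}) h"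
    and bound: "\<And>x. 0 \<le> x \<Longrightarrow> integral\<^sup>L (lebesgue_on {0<..x}) h \<le> K"
    and nonneg: "\<And>x. 0 \<le> h x"
  shows "integrable pos_measure h"
proof -
  let ?h = "\<lambda>n t. if t \<le> real n then h t else 0"
  have i: "integrable pos_measure (?h n)" for n
    using int[of "real n"] by (simp add: integrable_lebesgue_on_initial_iff)
  have val: "integral\<^sup>L pos_measure (?h n) = integral\<^sup>L (lebesgue_on {0<..real n}) h" for n
    by (rule integral_lebesgue_on_initial)
  have "incseq (\<lambda>n. integral\<^sup>L pos_measure (?h n))"
    by (rule incseq_SucI) (intro integral_mono i, auto simp: nonneg)
  moreover have "\<forall>n. integral\<^sup>L pos_measure (?h n) \<le> K"
    unfolding val using bound by simp
  ultimately obtain L where L: "(\<lambda>n. integral\<^sup>L pos_measure (?h n)) \<longlonglongrightarrow> L"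
    by (rule incseq_convergent[of _ K]) blast
  have lim: "(\<lambda>n. ?h n t) \<longlonglongrightarrow> h t" for t
    by (rule tendsto_eventually)
      (rule eventually_mono[OF eventually_ge_at_top[of "nat \<lceil>t\<rceil>"]], auto)
  have "h \<in> borel_measurable pos_measure"
    by (rule borel_measurable_LIMSEQ_metric[OF _ lim]) (rule borel_measurable_integrable[OF i])
  with i _ _ L show ?thesis
  proof (rule integrable_monotone_convergence)
    show "AE t in pos_measure. mono (\<lambda>n. ?h n t)"
      by (rule AE_I2) (simp add: mono_def nonneg)
    show "AE t in pos_measure. (\<lambda>n. ?h n t) \<longlonglongrightarrow> h t"
      by (rule AE_I2) (rule lim)
  qed
qed

text \<open>Dominated convergence with majorant |h'| carries the integrals over (0, x] to the
  integral over the half-line.\<close>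

lemma ac_with_deriv_tendsto:
  assumes ac: "ac_with_deriv h h'" and h': "integrable pos_measure h'"
  shows "(h \<longlongrightarrow> h 0 + integral\<^sup>L pos_measure h') at_top"
proof -
  have "((\<lambda>x. LINT t|pos_measure. (if t \<le> x then h' t else 0)) \<longlongrightarrow> integral\<^sup>L pos_measure h') at_top"
  proof (rule integral_dominated_convergence_at_top[where w = "\<lambda>t. norm (h' t)"])
    show "AE t in pos_measure. ((\<lambda>x. if t \<le> x then h' t else 0) \<longlongrightarrow> h' t) at_top"
    proof (rule AE_I2)
      fix t :: real
      show "((\<lambda>x. if t \<le> x then h' t else 0) \<longlongrightarrow> h' t) at_top"
        by (rule tendsto_eventually) (rule eventually_mono[OF eventually_ge_at_top[of t]], auto)
    qed
  qed (use h' in \<open>auto intro!: measurable_If borel_measurable_integrable\<close>)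
  then have "((\<lambda>x. h 0 + integral\<^sup>L (lebesgue_on {0<..x}) h')
      \<longlongrightarrow> h 0 + integral\<^sup>L pos_measure h') at_top"
    unfolding integral_lebesgue_on_initial by (intro tendsto_add tendsto_const)
  moreover have "\<forall>\<^sub>F x in at_top. h 0 + integral\<^sup>L (lebesgue_on {0<..x}) h' = h x"
    using eventually_ge_at_top[of 0] by eventually_elim (simp add: ac_with_deriv_integral[OF ac])
  ultimately show ?thesis
    by (rule Lim_transform_eventually)
qed

text \<open>A limit L other than 0 would keep |h| above |L|/2 on a half-line, which has infinite
  measure.\<close>

lemma integrable_pos_tendsto_zero:
  fixes h :: "real \<Rightarrow> complex"
  assumes h: "integrable pos_measure h" and lim: "(h \<longlongrightarrow> L) at_top"
  shows "L = 0"
proof (rule ccontr)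
  assume "L \<noteq> 0"
  then have "\<forall>\<^sub>F x in at_top. dist (h x) L < norm L / 2"
    by (intro tendstoD[OF lim]) simp
  then have "\<forall>\<^sub>F x in at_top. norm L / 2 \<le> norm (h x)"
  proof eventually_elim
    case (elim x)
    then show ?case
      using norm_triangle_ineq2[of L "h x"] by (simp add: dist_norm norm_minus_commute)
  qed
  then obtain N where N: "\<And>x. N \<le> x \<Longrightarrow> norm L / 2 \<le> norm (h x)"
    by (auto simp: eventually_at_top_linorder)
  define a where "a = max N 0"
  have "integrable (lebesgue_on {a<..}) h"
    by (rule integrable_lebesgue_on_mono[OF h]) (auto simp: a_def)
  then have "integrable (lebesgue_on {a<..}) (\<lambda>x. norm L / 2)"
  proof (rule Bochner_Integration.integrable_bound)
    show "AE x in lebesgue_on {a<..}. norm (norm L / 2) \<le> norm (h x)"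
    proof (rule AE_I2)
      fix x
      assume "x \<in> space (lebesgue_on {a<..})"
      then have "N \<le> x" by (simp add: a_def)
      from N[OF this] show "norm (norm L / 2) \<le> norm (h x)" by simp
    qed
  qed simp
  then have fin: "emeasure lebesgue {a<..} < \<infinity>"
    using \<open>L \<noteq> 0\<close>
    by (auto simp: integrable_iff_bounded emeasure_restrict_space ennreal_mult_less_top
        top.not_eq_extremum)
  then obtain r where r: "0 \<le> r" "emeasure lebesgue {a<..} = ennreal r"
    by (metis infinity_ennreal_def less_top_ennreal)
  \<comment> \<open>A half-line of finite measure \<open>r\<close> would contain an interval of
    length r + 1.\<close>
  have "emeasure lebesgue {a<..a + (r + 1)} \<le> emeasure lebesgue {a<..}"
    by (intro emeasure_mono) auto
  then show False
    using r by simp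
qed

text \<open>This removes the boundary term at infinity in integrations by parts: integrability of
  \<open>h'\<close> gives \<open>h\<close> a limit, and integrability of \<open>h\<close> forces
  that limit to be 0.\<close>

lemma ac_with_deriv_integral_pos:
  assumes "ac_with_deriv h h'" "integrable pos_measure h" "integrable pos_measure h'"
  shows "integral\<^sup>L pos_measure h' = - h 0"
  using integrable_pos_tendsto_zero[OF assms(2) ac_with_deriv_tendsto[OF assms(1,3)]]
  by (simp add: add_eq_0_iff)

subsection \<open>The space of square integrable functions\<close>

lemma L2_posD:
  assumes "f \<in> L2_pos"
  shows "f \<in> borel_measurable pos_measure" "integrable pos_measure (\<lambda>x. (cmod (f x))\<^sup>2)"
  using assms by (auto simp: L2_pos_def)

lemma L2_pos_mult_integrable:
  assumes f: "f \<in> L2_pos" and g: "g \<in> L2_pos"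
  shows "integrable pos_measure (\<lambda>x. f x * g x)"
proof (rule Bochner_Integration.integrable_bound)
  show "integrable pos_measure (\<lambda>x. (cmod (f x))\<^sup>2 + (cmod (g x))\<^sup>2)"
    using L2_posD[OF f] L2_posD[OF g] by simp
  show "(\<lambda>x. f x * g x) \<in> borel_measurable pos_measure"
    using L2_posD[OF f] L2_posD[OF g] by simp
  have "a * b \<le> a\<^sup>2 + b\<^sup>2" if "0 \<le> a" "0 \<le> b" for a b :: real
    using sum_squares_bound[of a b] that mult_nonneg_nonneg[OF that] by linarith
  then show "AE x in pos_measure. norm (f x * g x) \<le> norm ((cmod (f x))\<^sup>2 + (cmod (g x))\<^sup>2)"
    by (simp add: norm_mult)
qed

lemma borel_measurable_cnj [measurable (raw)]:
  "f \<in> borel_measurable M \<Longrightarrow> (\<lambda>x. cnj (f x)) \<in> borel_measurable M"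
  by (rule measurable_compose[of f]) (auto intro!: borel_measurable_continuous_onI continuous_intros)

lemma L2_pos_cnj: "f \<in> L2_pos \<Longrightarrow> (\<lambda>x. cnj (f x)) \<in> L2_pos"
  by (simp add: L2_pos_def borel_measurable_cnj)

lemma L2_pos_inner_integrable:
  "f \<in> L2_pos \<Longrightarrow> g \<in> L2_pos \<Longrightarrow> integrable pos_measure (\<lambda>x. f x * cnj (g x))"
  by (intro L2_pos_mult_integrable L2_pos_cnj)

lemma L2_pos_zero: "(\<lambda>x. 0) \<in> L2_pos"
  by (simp add: L2_pos_def)

lemma L2_pos_cmult: "f \<in> L2_pos \<Longrightarrow> (\<lambda>x. c * f x) \<in> L2_pos"
  by (simp add: L2_pos_def norm_mult power_mult_distrib borel_measurable_times)

lemma L2_pos_add: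
  assumes f: "f \<in> L2_pos" and g: "g \<in> L2_pos"
  shows "(\<lambda>x. f x + g x) \<in> L2_pos"
  unfolding L2_pos_def
proof (intro CollectI conjI)
  show m: "(\<lambda>x. f x + g x) \<in> borel_measurable pos_measure"
    using L2_posD[OF f] L2_posD[OF g] by simp
  have b: "(cmod (a + b))\<^sup>2 \<le> 2 * (cmod a)\<^sup>2 + 2 * (cmod b)\<^sup>2" for a b
  proof -
    have "(cmod (a + b))\<^sup>2 \<le> (cmod a + cmod b)\<^sup>2"
      by (intro power_mono norm_triangle_ineq) simp
    also have "\<dots> \<le> 2 * (cmod a)\<^sup>2 + 2 * (cmod b)\<^sup>2"
      using sum_squares_bound[of "cmod a" "cmod b"] by (simp add: power2_sum)
    finally show ?thesis .
  qed
  show "integrable pos_measure (\<lambda>x. (cmod (f x + g x))\<^sup>2)"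
  proof (rule Bochner_Integration.integrable_bound)
    show "integrable pos_measure (\<lambda>x. 2 * (cmod (f x))\<^sup>2 + 2 * (cmod (g x))\<^sup>2)"
      using L2_posD[OF f] L2_posD[OF g] by simp
  qed (use m b in auto)
qed

lemma L2_pos_sum:
  "(\<And>i. i \<in> I \<Longrightarrow> f i \<in> L2_pos) \<Longrightarrow> (\<lambda>x. \<Sum>i\<in>I. f i x) \<in> L2_pos"
  by (induction I rule: infinite_finite_induct) (auto intro: L2_pos_zero L2_pos_add)

text \<open>On a bounded interval constants are integrable, and |f| <= 1 + |f|^2.\<close>

lemma L2_pos_locally_integrable:
  assumes "f \<in> L2_pos"
  shows "integrable (lebesgue_on {0<..x}) f"
proof (rule Bochner_Integration.integrable_bound)
  have "finite_measure (lebesgue_on {0<..x})"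
    by (intro finite_measure_lebesgue_on bounded_set_imp_lmeasurable) auto
  then have "integrable (lebesgue_on {0<..x}) (\<lambda>t. 1 :: real)"
    by (rule finite_measure.integrable_const)
  then show "integrable (lebesgue_on {0<..x}) (\<lambda>t. 1 + (cmod (f t))\<^sup>2)"
    using integrable_lebesgue_on_initial[OF L2_posD(2)[OF assms]]
    by (intro Bochner_Integration.integrable_add)
  have "f \<in> borel_measurable (restrict_space pos_measure {0<..x})"
    using L2_posD(1)[OF assms] by (rule measurable_restrict_space1)
  then show "f \<in> borel_measurable (lebesgue_on {0<..x})"
    by (simp add: restrict_restrict_space Int_absorb1 greaterThanAtMost_def)
  have "a \<le> 1 + a\<^sup>2" for a :: real
    using sum_squares_bound[of a 1] zero_le_power2[of a] unfolding power_one by linarith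
  then show "AE t in lebesgue_on {0<..x}. norm (f t) \<le> norm (1 + (cmod (f t))\<^sup>2)"
    by simp
qed

lemma L2_inner_cong_AE:
  assumes "f \<in> borel_measurable pos_measure" "f' \<in> borel_measurable pos_measure"
    and "g \<in> borel_measurable pos_measure" "g' \<in> borel_measurable pos_measure"
    and "AE x in pos_measure. f x = f' x" "AE x in pos_measure. g x = g' x"
  shows "L2_inner f g = L2_inner f' g'"
  unfolding L2_inner_def
proof (rule integral_cong_AE)
  show "AE x in pos_measure. f x * cnj (g x) = f' x * cnj (g' x)"
    using assms(5,6) by eventually_elim simp
qed (use assms in \<open>simp_all add: borel_measurable_cnj borel_measurable_times\<close>)

lemma L2_inner_add_left:
  "f \<in> L2_pos \<Longrightarrow> g \<in> L2_pos \<Longrightarrow> h \<in> L2_pos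
    \<Longrightarrow> L2_inner (\<lambda>x. f x + g x) h = L2_inner f h + L2_inner g h"
  by (simp add: L2_inner_def distrib_right L2_pos_inner_integrable)

lemma L2_inner_cmult_left: "L2_inner (\<lambda>x. c * f x) h = c * L2_inner f h"
  by (simp add: L2_inner_def mult.assoc)

lemma L2_inner_sum_left:
  assumes "\<And>i. i \<in> I \<Longrightarrow> f i \<in> L2_pos" "h \<in> L2_pos"
  shows "L2_inner (\<lambda>x. \<Sum>i\<in>I. f i x) h = (\<Sum>i\<in>I. L2_inner (f i) h)"
  using assms by (simp add: L2_inner_def sum_distrib_right L2_pos_inner_integrable
      Bochner_Integration.integral_sum)

lemma L2_inner_commute: "L2_inner g f = cnj (L2_inner f g)"
proof -
  have "(\<lambda>x. g x * cnj (f x)) = (\<lambda>x. cnj (f x * cnj (g x)))"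
    by (simp add: mult.commute)
  then show ?thesis
    unfolding L2_inner_def by (simp only: Bochner_Integration.integral_cnj)
qed

lemma L2_inner_self:
  "L2_inner f f = complex_of_real (LINT x|pos_measure. (cmod (f x))\<^sup>2)"
proof -
  have "L2_inner f f = (LINT x|pos_measure. complex_of_real ((cmod (f x))\<^sup>2))"
    unfolding L2_inner_def by (simp only: complex_norm_square)
  then show ?thesis
    by (simp only: integral_complex_of_real)
qed

lemma L2_inner_self_eq_0:
  assumes "f \<in> L2_pos" "L2_inner f f = 0"
  shows "AE x in pos_measure. f x = 0"
  using assms integral_nonneg_eq_0_iff_AE[OF L2_posD(2)[OF assms(1)]]
  by (simp add: L2_inner_self)

subsection \<open>The free operator\<close>

text \<open>Integrating (u' cnj u)' = u'' cnj u + |u'|^2 leaves no boundary term, since u vanishes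
  at 0 and the products are integrable. Hence the inner product equals minus the squared norm of
  u'.\<close>

lemma W22_inner_deriv2_real:
  assumes W: "W22_with_derivs u u1 u2" and u0: "u 0 = 0"
  shows "L2_inner u2 u \<in> \<real>"
proof -
  have L2: "u \<in> L2_pos" "u1 \<in> L2_pos" "u2 \<in> L2_pos"
    and ac: "ac_with_deriv u u1" "ac_with_deriv u1 u2"
    using W by (auto simp: W22_with_derivs_def)
  have "(LINT x|pos_measure. u2 x * cnj (u x) + u1 x * cnj (u1 x)) = - (u1 0 * cnj (u 0))"
    by (rule ac_with_deriv_integral_pos[OF ac_with_deriv_mult[OF ac(2) ac_with_deriv_cnj[OF ac(1)]]])
      (intro Bochner_Integration.integrable_add L2_pos_inner_integrable L2)+
  then have "L2_inner u2 u + L2_inner u1 u1 = 0"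
    using L2 u0 by (simp add: L2_inner_def L2_pos_inner_integrable)
  then have "L2_inner u2 u = - L2_inner u1 u1"
    by (simp add: add_eq_0_iff2)
  then show ?thesis
    by (simp add: L2_inner_self)
qed

lemma L_freeD:
  assumes "(y, f) \<in> L_free"
  shows "y \<in> L2_pos" "f \<in> L2_pos"
  using assms by (auto simp: L_free_def)

lemma L_freeI:
  "y \<in> L2_pos \<Longrightarrow> f \<in> L2_pos \<Longrightarrow> W22_with_derivs u u1 u2 \<Longrightarrow> u 0 = 0 \<Longrightarrow>
    AE x in pos_measure. y x = u x \<Longrightarrow> AE x in pos_measure. f x = - u2 x \<Longrightarrow> (y, f) \<in> L_free"
  unfolding L_free_def by blast

text \<open>Reality of the quadratic form is the shape in which the symmetry of the free operator
  enters the uniqueness argument.\<close>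

lemma L_free_inner_real:
  assumes "(y, f) \<in> L_free"
  shows "L2_inner f y \<in> \<real>"
proof -
  obtain u u1 u2 where W: "W22_with_derivs u u1 u2" and u0: "u 0 = 0"
    and y: "AE x in pos_measure. y x = u x" and f: "AE x in pos_measure. f x = - u2 x"
    using assms by (auto simp: L_free_def)
  have "u \<in> L2_pos" "u2 \<in> L2_pos"
    using W by (auto simp: W22_with_derivs_def)
  then have "L2_inner f y = L2_inner (\<lambda>x. -1 * u2 x) u"
    using L_freeD[OF assms] y f by (intro L2_inner_cong_AE) (auto intro: L2_posD)
  then show ?thesis
    using W22_inner_deriv2_real[OF W u0] unfolding L2_inner_cmult_left by simp
qed

lemma L_free_cong_AE:
  assumes "(y, f) \<in> L_free" "f' \<in> L2_pos" "AE x in pos_measure. f' x = f x"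
  shows "(y, f') \<in> L_free"
proof -
  obtain u u1 u2 where u: "W22_with_derivs u u1 u2" "u 0 = 0"
    "AE x in pos_measure. y x = u x" "AE x in pos_measure. f x = - u2 x"
    using assms(1) by (auto simp: L_free_def)
  have "AE x in pos_measure. f' x = - u2 x"
    using assms(3) u(4) by eventually_elim simp
  then show ?thesis
    using u assms(2) L_freeD[OF assms(1)] unfolding L_free_def by blast
qed

lemma L_free_add:
  assumes "(y, f) \<in> L_free" "(w, g) \<in> L_free"
  shows "(\<lambda>x. y x + w x, \<lambda>x. f x + g x) \<in> L_free"
proof -
  obtain u u1 u2 where u: "W22_with_derivs u u1 u2" "u 0 = 0"
    "AE x in pos_measure. y x = u x" "AE x in pos_measure. f x = - u2 x"
    using assms(1) by (auto simp: L_free_def)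
  obtain v v1 v2 where v: "W22_with_derivs v v1 v2" "v 0 = 0"
    "AE x in pos_measure. w x = v x" "AE x in pos_measure. g x = - v2 x"
    using assms(2) by (auto simp: L_free_def)
  have "W22_with_derivs (\<lambda>x. u x + v x) (\<lambda>x. u1 x + v1 x) (\<lambda>x. u2 x + v2 x)"
    using u(1) v(1) by (simp add: W22_with_derivs_def L2_pos_add ac_with_deriv_add)
  moreover have "AE x in pos_measure. y x + w x = u x + v x"
    using u(3) v(3) by eventually_elim simp
  moreover have "AE x in pos_measure. f x + g x = - (u2 x + v2 x)"
    using u(4) v(4) by eventually_elim simp
  moreover have "u 0 + v 0 = 0"
    using u(2) v(2) by simp
  ultimately show ?thesis
    using L_freeD[OF assms(1)] L_freeD[OF assms(2)]
    by (intro L_freeI[of _ _ "\<lambda>x. u x + v x"]) (auto intro: L2_pos_add)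
qed

lemma L_free_cmult:
  assumes "(y, f) \<in> L_free"
  shows "(\<lambda>x. c * y x, \<lambda>x. c * f x) \<in> L_free"
proof -
  obtain u u1 u2 where u: "W22_with_derivs u u1 u2" "u 0 = 0"
    "AE x in pos_measure. y x = u x" "AE x in pos_measure. f x = - u2 x"
    using assms(1) by (auto simp: L_free_def)
  have "W22_with_derivs (\<lambda>x. c * u x) (\<lambda>x. c * u1 x) (\<lambda>x. c * u2 x)"
    using u(1) by (simp add: W22_with_derivs_def L2_pos_cmult ac_with_deriv_cmult)
  moreover have "AE x in pos_measure. c * y x = c * u x"
    using u(3) by eventually_elim simp
  moreover have "AE x in pos_measure. c * f x = - (c * u2 x)"
    using u(4) by eventually_elim simp
  moreover have "c * u 0 = 0"
    using u(2) by simp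
  ultimately show ?thesis
    using L_freeD[OF assms(1)]
    by (intro L_freeI[of _ _ "\<lambda>x. c * u x"]) (auto intro: L2_pos_cmult)
qed

section \<open>First-order linear equations and the free resolvent equation\<close>

text \<open>
  Integrate \<open>Re c * (\<bar>h\<bar>\<^sup>2)' = 2 (Re c)\<^sup>2 \<bar>h\<bar>\<^sup>2 + 2 Re c Re (f cnj h) \<ge> (Re c)\<^sup>2 \<bar>h\<bar>\<^sup>2 - \<bar>f\<bar>\<^sup>2\<close>.
\<close>

lemma ac_with_deriv_linear_ode_L2:
  assumes ac: "ac_with_deriv h (\<lambda>x. c * h x + f x)" and f: "f \<in> L2_pos" and c: "Re c \<noteq> 0"
    and B: "\<And>x. 0 \<le> x \<Longrightarrow> Re c * (cmod (h x))\<^sup>2 \<le> B"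
  shows "h \<in> L2_pos"
proof -
  have c0: "c \<noteq> 0" using c by auto
  have loc_h: "integrable (lebesgue_on {0<..x}) h" if "0 \<le> x" for x
  proof -
    \<comment> \<open>The equation recovers h as (h' - f) / c, and both h' and f are locally
      integrable.\<close>
    have "integrable (lebesgue_on {0<..x}) (\<lambda>t. inverse c * ((c * h t + f t) - f t))"
      using ac_with_deriv_integrable[OF ac that] L2_pos_locally_integrable[OF f]
      by (intro integrable_mult_right Bochner_Integration.integrable_diff)
    then show ?thesis using c0 by (simp add: field_simps)
  qed
  have loc_h2: "integrable (lebesgue_on {0<..x}) (\<lambda>t. (cmod (h t))\<^sup>2)" if "0 \<le> x" for x
  proof -
    \<comment> \<open>Read |h|^2 as h times the derivative of an indefinite integral of cnj h; the
      product rule then supplies its integrability.\<close>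
    have "ac_with_deriv (\<lambda>x. integral\<^sup>L (lebesgue_on {0<..x}) (\<lambda>t. cnj (h t))) (\<lambda>t. cnj (h t))"
      using loc_h by (intro ac_with_deriv_indefinite) simp
    from ac_with_deriv_mult_integral(1)[OF ac this that]
    have "integrable (lebesgue_on {0<..x}) (\<lambda>t. complex_of_real ((cmod (h t))\<^sup>2))"
      by (simp only: complex_norm_square)
    then show ?thesis by (simp only: complex_of_real_integrable_eq)
  qed
  have loc_f2: "integrable (lebesgue_on {0<..x}) (\<lambda>t. (cmod (f t))\<^sup>2)" for x
    using L2_posD(2)[OF f] by (rule integrable_lebesgue_on_initial)
  \<comment> \<open>\<open>e\<close> is the derivative of |h|^2 in real form.\<close>
  define e where "e t = 2 * Re c * (cmod (h t))\<^sup>2 + 2 * Re (f t * cnj (h t))" for t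
  have e: "(c * h t + f t) * cnj (h t) + h t * cnj (c * h t + f t) = complex_of_real (e t)" for t
    unfolding e_def cmod_power2 unfolding power2_eq_square
    by (rule complex_eqI) (simp_all add: algebra_simps)
  have N: "ac_with_deriv (\<lambda>x. complex_of_real ((cmod (h x))\<^sup>2)) (\<lambda>t. complex_of_real (e t))"
    using ac_with_deriv_mult[OF ac ac_with_deriv_cnj[OF ac]]
    unfolding e complex_norm_square[symmetric] .
  have loc_e: "integrable (lebesgue_on {0<..x}) e" if "0 \<le> x" for x
    using ac_with_deriv_integrable[OF N that] by (simp only: complex_of_real_integrable_eq)
  have int_e: "integral\<^sup>L (lebesgue_on {0<..x}) e = (cmod (h x))\<^sup>2 - (cmod (h 0))\<^sup>2" if "0 \<le> x" for x
    using ac_with_deriv_integral[OF N that]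
    unfolding integral_complex_of_real of_real_diff[symmetric] of_real_eq_iff .
  have pointwise: "(Re c)\<^sup>2 * (cmod (h t))\<^sup>2 \<le> Re c * e t + (cmod (f t))\<^sup>2" for t
  proof -
    have "\<bar>Re (f t * cnj (h t))\<bar> \<le> cmod (f t) * cmod (h t)"
      using abs_Re_le_cmod[of "f t * cnj (h t)"] by (simp add: norm_mult)
    then have "\<bar>Re c * Re (f t * cnj (h t))\<bar> \<le> \<bar>Re c\<bar> * (cmod (f t) * cmod (h t))"
      unfolding abs_mult by (rule mult_left_mono) simp
    \<comment> \<open>Expanding this square bounds the mixed term, at the cost of half of the
      summand 2 (Re c)^2 |h|^2 in \<open>Re c * e t\<close>.\<close>
    moreover have "0 \<le> (\<bar>Re c\<bar> * cmod (h t) - cmod (f t))\<^sup>2"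
      by simp
    then have "2 * (\<bar>Re c\<bar> * (cmod (f t) * cmod (h t))) \<le> (Re c)\<^sup>2 * (cmod (h t))\<^sup>2 + (cmod (f t))\<^sup>2"
      by (simp add: power2_diff power_mult_distrib algebra_simps)
    ultimately have "- (2 * (Re c * Re (f t * cnj (h t))))
        \<le> (Re c)\<^sup>2 * (cmod (h t))\<^sup>2 + (cmod (f t))\<^sup>2"
      by linarith
    moreover have "Re c * e t
        = 2 * ((Re c)\<^sup>2 * (cmod (h t))\<^sup>2) + 2 * (Re c * Re (f t * cnj (h t)))"
      unfolding e_def by (simp add: power2_eq_square algebra_simps)
    ultimately show ?thesis by linarith
  qed
  \<comment> \<open>Integrating \<open>pointwise\<close> over (0, x] gives a boundary term at x and
    one at 0. The one-sided bound \<open>B\<close> controls the former whatever the sign of Re c,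
    and for Re c < 0 the choice B = 0 is available.\<close>
  define K where "K = B - Re c * (cmod (h 0))\<^sup>2 + (LINT t|pos_measure. (cmod (f t))\<^sup>2)"
  have "integrable pos_measure (\<lambda>t. (Re c)\<^sup>2 * (cmod (h t))\<^sup>2)"
  proof (rule integrable_pos_bounded_local)
    fix x :: real
    assume x: "0 \<le> x"
    show i: "integrable (lebesgue_on {0<..x}) (\<lambda>t. (Re c)\<^sup>2 * (cmod (h t))\<^sup>2)"
      using loc_h2[OF x] by simp
    have "(LINT t|lebesgue_on {0<..x}. (Re c)\<^sup>2 * (cmod (h t))\<^sup>2)
        \<le> (LINT t|lebesgue_on {0<..x}. Re c * e t + (cmod (f t))\<^sup>2)"
      using loc_e[OF x] loc_f2 by (intro integral_mono i pointwise) simp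
    also have "\<dots> = Re c * ((cmod (h x))\<^sup>2 - (cmod (h 0))\<^sup>2)
        + (LINT t|lebesgue_on {0<..x}. (cmod (f t))\<^sup>2)"
      using loc_e[OF x] loc_f2 int_e[OF x] by simp
    also have "(LINT t|lebesgue_on {0<..x}. (cmod (f t))\<^sup>2) \<le> (LINT t|pos_measure. (cmod (f t))\<^sup>2)"
      by (rule integral_mono_lebesgue_on_AE[OF L2_posD(2)[OF f]]) auto
    finally show "(LINT t|lebesgue_on {0<..x}. (Re c)\<^sup>2 * (cmod (h t))\<^sup>2) \<le> K"
      using B[OF x] by (simp add: K_def right_diff_distrib)
  qed simp
  then have "integrable pos_measure (\<lambda>t. (cmod (h t))\<^sup>2)"
    using c by simp
  then show ?thesis
    using borel_measurable_pos_local[OF loc_h] by (simp add: L2_pos_def)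
qed

text \<open>The exponential solves h' = c h, so the energy estimate applies with zero
  inhomogeneity.\<close>

lemma exp_L2_pos:
  assumes "Re c < 0"
  shows "(\<lambda>x. exp (c * complex_of_real x)) \<in> L2_pos"
proof (rule ac_with_deriv_linear_ode_L2[where c = c and f = "\<lambda>x. 0" and B = 0])
  show "ac_with_deriv (\<lambda>x. exp (c * complex_of_real x)) (\<lambda>x. c * exp (c * complex_of_real x) + 0)"
    using ac_with_deriv_exp by simp
  show "Re c * (cmod (exp (c * complex_of_real x)))\<^sup>2 \<le> 0" for x
    using assms by (simp add: mult_nonpos_nonneg)
qed (use assms L2_pos_zero in auto)

text \<open>The product rule for the exponential and an indefinite integral of
  \<open>f\<close>.\<close>

lemma exp_times_L2_locally_integrable:
  assumes "f \<in> L2_pos" "0 \<le> x"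
  shows "integrable (lebesgue_on {0<..x}) (\<lambda>t. exp (c * complex_of_real t) * f t)"
  using ac_with_deriv_mult_integral(1)[OF ac_with_deriv_exp
      ac_with_deriv_indefinite[OF L2_pos_locally_integrable[OF assms(1)]] assms(2)] .

lemma exp_minus_mult_exp:
  fixes a b :: complex
  shows "exp (- a) * (exp a * b) = b"
  by (simp add: exp_minus)

lemma exp_mult_exp_minus:
  fixes a b :: complex
  shows "exp a * (exp (- a) * b) = b"
  by (simp add: exp_minus)

text \<open>Variation of constants starting from 0. The coefficient has negative real part, so the
  energy estimate needs no bound on the solution.\<close>

lemma linear_ode_decaying_solution:
  assumes f: "f \<in> L2_pos" and \<kappa>: "0 < Re \<kappa>"
  shows "\<exists>p\<in>L2_pos. ac_with_deriv p (\<lambda>x. - \<kappa> * p x + f x)"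
proof -
  define p where "p x = exp (- \<kappa> * complex_of_real x)
    * integral\<^sup>L (lebesgue_on {0<..x}) (\<lambda>t. exp (\<kappa> * complex_of_real t) * f t)" for x
  have "ac_with_deriv p (\<lambda>x. - \<kappa> * p x + f x)"
  proof (rule ac_with_deriv_cong)
    show "ac_with_deriv (\<lambda>x. exp (- \<kappa> * complex_of_real x)
        * integral\<^sup>L (lebesgue_on {0<..x}) (\<lambda>t. exp (\<kappa> * complex_of_real t) * f t))
      (\<lambda>x. (- \<kappa> * exp (- \<kappa> * complex_of_real x))
          * integral\<^sup>L (lebesgue_on {0<..x}) (\<lambda>t. exp (\<kappa> * complex_of_real t) * f t)
        + exp (- \<kappa> * complex_of_real x) * (exp (\<kappa> * complex_of_real x) * f x))"
      by (intro ac_with_deriv_mult ac_with_deriv_exp ac_with_deriv_indefinite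
          exp_times_L2_locally_integrable[OF f])
  qed (simp_all add: p_def fun_eq_iff exp_minus_mult_exp)
  moreover from this have "p \<in> L2_pos"
    by (rule ac_with_deriv_linear_ode_L2[where B = 0])
      (use f \<kappa> in \<open>auto intro: mult_nonneg_nonneg\<close>)
  ultimately show ?thesis by blast
qed

text \<open>The tail is the integral over the half-line minus the one over (0, x], both read off
  from the derivative of exp(-2 a x). It serves to bound the growing solution below.\<close>

lemma exp_tail_integral:
  fixes a x :: real
  assumes a: "0 < a" and x: "0 \<le> x"
  shows "integrable pos_measure (\<lambda>t. if t \<le> x then 0 else exp (- (2 * a * t)))" (is ?int)
    and "(LINT t|pos_measure. (if t \<le> x then 0 else exp (- (2 * a * t)))) = exp (- (2 * a * x)) / (2 * a)"
      (is ?val)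
proof -
  let ?e = "\<lambda>t. exp (- (2 * a * t))"
  define c where "c = complex_of_real (- (2 * a))"
  have ce: "c * exp (c * complex_of_real t) = complex_of_real (- (2 * a) * ?e t)" for t
    by (simp add: c_def exp_of_real[symmetric])
  have ac: "ac_with_deriv (\<lambda>x. exp (c * complex_of_real x)) (\<lambda>t. complex_of_real (- (2 * a) * ?e t))"
    using ac_with_deriv_exp[of c] unfolding ce .
  \<comment> \<open>exp(-2 a t) is the squared modulus of exp(-a t), hence integrable.\<close>
  have "(\<lambda>x. exp (complex_of_real (- a) * complex_of_real x)) \<in> L2_pos"
    using a by (intro exp_L2_pos) simp
  from L2_posD(2)[OF this] have i: "integrable pos_measure ?e"
    by (simp add: norm_exp_eq_Re exp_double[symmetric] mult.assoc)
  have ix: "integrable pos_measure (\<lambda>t. if t \<le> x then ?e t else 0)"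
    unfolding integrable_lebesgue_on_initial_iff using i by (rule integrable_lebesgue_on_initial)
  have eq: "(if t \<le> x then 0 else ?e t) = ?e t - (if t \<le> x then ?e t else 0)" for t
    by simp
  show ?int
    unfolding eq using i ix by (rule Bochner_Integration.integrable_diff)
  have ec: "exp (c * complex_of_real t) = complex_of_real (?e t)" for t
    by (simp add: c_def exp_of_real[symmetric])
  have "(LINT t|pos_measure. complex_of_real (- (2 * a) * ?e t)) = - exp (c * complex_of_real 0)"
  proof (rule ac_with_deriv_integral_pos[OF ac])
    show "integrable pos_measure (\<lambda>x. exp (c * complex_of_real x))"
      unfolding ec using i by (simp only: complex_of_real_integrable_eq)
    show "integrable pos_measure (\<lambda>t. complex_of_real (- (2 * a) * ?e t))"
      using i by (simp only: complex_of_real_integrable_eq integrable_mult_right)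
  qed
  then have "complex_of_real (- (2 * a) * integral\<^sup>L pos_measure ?e) = complex_of_real (- 1)"
    unfolding integral_complex_of_real by simp
  then have v: "2 * a * integral\<^sup>L pos_measure ?e = 1"
    unfolding of_real_eq_iff by simp
  have "complex_of_real (LINT t|lebesgue_on {0<..x}. - (2 * a) * ?e t) = complex_of_real (?e x - 1)"
    using ac_with_deriv_integral[OF ac x] unfolding integral_complex_of_real ec by simp
  then have vx: "- (2 * a) * integral\<^sup>L (lebesgue_on {0<..x}) ?e = ?e x - 1"
    unfolding of_real_eq_iff by simp
  have "(LINT t|pos_measure. (if t \<le> x then 0 else ?e t))
      = integral\<^sup>L pos_measure ?e - integral\<^sup>L (lebesgue_on {0<..x}) ?e"
    unfolding eq integral_lebesgue_on_initial[symmetric]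
    using i ix by (rule Bochner_Integration.integral_diff)
  moreover have "T * (2 * a) = 2 * a * A + - (2 * a) * B" if "T = A - B" for T A B :: real
    by (simp add: that algebra_simps)
  ultimately have "(LINT t|pos_measure. (if t \<le> x then 0 else ?e t)) * (2 * a)
      = 2 * a * integral\<^sup>L pos_measure ?e + - (2 * a) * integral\<^sup>L (lebesgue_on {0<..x}) ?e"
    by blast
  also have "\<dots> = ?e x"
    unfolding v vx by simp
  finally show ?val
    using a by (intro nonzero_eq_divide_eq[THEN iffD2]) simp_all
qed

text \<open>Here the constants are varied from infinity, which singles out the bounded solution. The
  coefficient has positive real part, so the energy estimate requires an explicit bound on
  \<open>q\<close>.\<close>

lemma linear_ode_growing_solution:
  assumes f: "f \<in> L2_pos" and \<kappa>: "0 < Re \<kappa>"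
  shows "\<exists>q\<in>L2_pos. ac_with_deriv q (\<lambda>x. \<kappa> * q x - f x)"
proof -
  define a where "a = Re \<kappa>"
  let ?g = "\<lambda>t. exp (- \<kappa> * complex_of_real t) * f t"
  \<comment> \<open>The second factor is the integral of \<open>?g\<close> over (x, infinity),
    written as a difference so that it is visibly an indefinite integral.\<close>
  define q where "q x = exp (\<kappa> * complex_of_real x)
    * (integral\<^sup>L pos_measure ?g + -1 * integral\<^sup>L (lebesgue_on {0<..x}) ?g)" for x
  define F where "F = (LINT t|pos_measure. (cmod (f t))\<^sup>2)"
  have ac: "ac_with_deriv q (\<lambda>x. \<kappa> * q x + -1 * f x)"
  proof (rule ac_with_deriv_cong)
    show "ac_with_deriv (\<lambda>x. exp (\<kappa> * complex_of_real x)
        * (integral\<^sup>L pos_measure ?g + -1 * integral\<^sup>L (lebesgue_on {0<..x}) ?g))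
      (\<lambda>x. (\<kappa> * exp (\<kappa> * complex_of_real x))
          * (integral\<^sup>L pos_measure ?g + -1 * integral\<^sup>L (lebesgue_on {0<..x}) ?g)
        + exp (\<kappa> * complex_of_real x) * (0 + -1 * ?g x))"
      by (intro ac_with_deriv_mult ac_with_deriv_exp ac_with_deriv_add ac_with_deriv_const
          ac_with_deriv_cmult ac_with_deriv_indefinite exp_times_L2_locally_integrable[OF f])
  qed (simp_all add: q_def fun_eq_iff exp_mult_exp_minus)
  have ig: "integrable pos_measure ?g"
    using \<kappa> by (intro L2_pos_mult_integrable f exp_L2_pos) simp
  have bound: "cmod (q x) \<le> 1 / (4 * a) + F / 2" if x: "0 \<le> x" for x
  proof -
    have igx: "integrable pos_measure (\<lambda>t. if t \<le> x then ?g t else 0)"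
      unfolding integrable_lebesgue_on_initial_iff using ig by (rule integrable_lebesgue_on_initial)
    have eq: "(if t \<le> x then 0 else ?g t) = ?g t - (if t \<le> x then ?g t else 0)" for t
      by simp
    have it: "integrable pos_measure (\<lambda>t. if t \<le> x then 0 else ?g t)"
      unfolding eq using ig igx by (rule Bochner_Integration.integrable_diff)
    have "integral\<^sup>L pos_measure ?g + -1 * integral\<^sup>L (lebesgue_on {0<..x}) ?g
        = (LINT t|pos_measure. (if t \<le> x then 0 else ?g t))"
      unfolding eq integral_lebesgue_on_initial[symmetric]
      using ig igx by (simp add: Bochner_Integration.integral_diff)
    then have "cmod (q x)
        = exp (a * x) * cmod (LINT t|pos_measure. (if t \<le> x then 0 else ?g t))"
      by (simp add: q_def norm_mult a_def norm_exp_eq_Re)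
    also have "\<dots> \<le> exp (a * x) * (LINT t|pos_measure. cmod (if t \<le> x then 0 else ?g t))"
      by (intro mult_left_mono integral_norm_bound) simp
    also have "\<dots> \<le> exp (a * x) * (LINT t|pos_measure.
        exp (a * x) / 2 * (if t \<le> x then 0 else exp (- (2 * a * t))) + exp (- (a * x)) / 2 * (cmod (f t))\<^sup>2)"
    proof (intro mult_left_mono integral_mono)
      show "integrable pos_measure (\<lambda>t. exp (a * x) / 2 * (if t \<le> x then 0 else exp (- (2 * a * t)))
          + exp (- (a * x)) / 2 * (cmod (f t))\<^sup>2)"
        using exp_tail_integral(1)[of a x] \<kappa> x L2_posD(2)[OF f]
        by (intro Bochner_Integration.integrable_add integrable_mult_right) (auto simp: a_def)
      show "cmod (if t \<le> x then 0 else ?g t)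
          \<le> exp (a * x) / 2 * (if t \<le> x then 0 else exp (- (2 * a * t))) + exp (- (a * x)) / 2 * (cmod (f t))\<^sup>2"
        for t
      proof (cases "t \<le> x")
        case False
        \<comment> \<open>This weight balances the inequality 2 A B <= A^2 + B^2: after integration
          over t > x and multiplication by exp(a x), all powers of exp(a x) cancel and the bound is
          independent of x.\<close>
        define u where "u = exp (a * x / 2)"
        have u0: "u \<noteq> 0" by (simp add: u_def)
        have ex: "exp (a * x) = u\<^sup>2" "exp (- (a * x)) = (inverse u)\<^sup>2"
          by (simp_all add: u_def exp_double[symmetric] exp_minus[symmetric])
        have et: "exp (- (2 * a * t)) = (exp (- (a * t)))\<^sup>2"
          by (simp add: exp_double[symmetric])
        have "2 * exp (- (a * t)) * cmod (f t) = 2 * (u * exp (- (a * t))) * (inverse u * cmod (f t))"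
          using u0 by simp
        also have "\<dots> \<le> (u * exp (- (a * t)))\<^sup>2 + (inverse u * cmod (f t))\<^sup>2"
          by (rule sum_squares_bound)
        also have "\<dots> = exp (a * x) * exp (- (2 * a * t)) + exp (- (a * x)) * (cmod (f t))\<^sup>2"
          unfolding ex et power_mult_distrib ..
        finally show ?thesis
          using False by (simp add: norm_mult norm_exp_eq_Re a_def)
      qed simp
    qed (use it in \<open>auto intro: integrable_norm\<close>)
    also have "\<dots> = exp (a * x) * (exp (a * x) / 2 * (exp (- (2 * a * x)) / (2 * a))
        + exp (- (a * x)) / 2 * F)"
      using exp_tail_integral[of a x] \<kappa> x L2_posD(2)[OF f] by (simp add: a_def F_def)
    also have "\<dots> = (exp (a * x) * exp (a * x) * exp (- (2 * a * x))) / (4 * a)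
        + (exp (a * x) * exp (- (a * x))) * F / 2"
      by (simp add: algebra_simps)
    also have "\<dots> = 1 / (4 * a) + F / 2"
      by (simp add: exp_add[symmetric])
    finally show ?thesis .
  qed
  have "q \<in> L2_pos"
  proof (rule ac_with_deriv_linear_ode_L2[OF ac])
    show "(\<lambda>x. -1 * f x) \<in> L2_pos"
      using f by (rule L2_pos_cmult)
    show "Re \<kappa> * (cmod (q x))\<^sup>2 \<le> Re \<kappa> * (1 / (4 * a) + F / 2)\<^sup>2" if "0 \<le> x" for x
      using \<kappa> bound[OF that] by (intro mult_left_mono power_mono) auto
  qed (use \<kappa> in auto)
  then show ?thesis
    using ac by auto
qed

text \<open>With p' = -\<kappa> p + f and q' = \<kappa> q - f, the function y = (p + q) / (2
  \<kappa>) has derivative (q - p) / 2 and second derivative \<kappa>^2 y - f = -z y - f. A multiple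
  of exp(-\<kappa> x), a solution of the homogeneous equation, adjusts the value at 0.\<close>

lemma L_free_solvable:
  assumes f: "f \<in> L2_pos" and z: "z \<notin> \<real>"
  shows "\<exists>y. (y, \<lambda>x. f x + z * y x) \<in> L_free"
proof -
  define \<kappa> where "\<kappa> = csqrt (- z)"
  have sq: "\<kappa> * \<kappa> = - z"
    unfolding \<kappa>_def by (metis power2_csqrt power2_eq_square)
  \<comment> \<open>A purely imaginary root would make z real; the principal root then has positive
    real part.\<close>
  have "Re \<kappa> \<noteq> 0"
  proof
    assume "Re \<kappa> = 0"
    then have "Im z = 0"
      using arg_cong[OF sq, of Im] by simp
    then show False
      using z by (simp add: complex_is_Real_iff)
  qed
  moreover have "0 \<le> Re \<kappa>"
    unfolding \<kappa>_def using csqrt_principal[of "- z"] by auto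
  ultimately have \<kappa>: "0 < Re \<kappa>" by simp
  then have \<kappa>0: "\<kappa> \<noteq> 0" by auto
  obtain p where p: "p \<in> L2_pos" "ac_with_deriv p (\<lambda>x. - \<kappa> * p x + f x)"
    using linear_ode_decaying_solution[OF f \<kappa>] by blast
  obtain q where q: "q \<in> L2_pos" "ac_with_deriv q (\<lambda>x. \<kappa> * q x - f x)"
    using linear_ode_growing_solution[OF f \<kappa>] by blast
  \<comment> \<open>The coefficient of the decaying exponential that makes
    \<open>y 0 = 0\<close>.\<close>
  define d where "d = p 0 + q 0"
  let ?E = "\<lambda>x. exp (- \<kappa> * complex_of_real x)"
  have E: "?E \<in> L2_pos"
    using \<kappa> by (intro exp_L2_pos) simp
  define y where "y x = 1 / (2 * \<kappa>) * ((p x + q x) + - d * ?E x)" for x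
  define y1 where "y1 x = 1 / 2 * ((-1 * p x + q x) + d * ?E x)" for x
  have y: "y \<in> L2_pos" "y1 \<in> L2_pos"
    unfolding y_def y1_def by (intro L2_pos_cmult L2_pos_add p q E)+
  have fy: "(\<lambda>x. f x + z * y x) \<in> L2_pos"
    by (intro L2_pos_add L2_pos_cmult f y)
  have "ac_with_deriv y y1"
  proof (rule ac_with_deriv_cong)
    show "ac_with_deriv (\<lambda>x. 1 / (2 * \<kappa>) * ((p x + q x) + - d * ?E x))
      (\<lambda>x. 1 / (2 * \<kappa>) * (((- \<kappa> * p x + f x) + (\<kappa> * q x - f x)) + - d * (- \<kappa> * ?E x)))"
      by (intro ac_with_deriv_cmult ac_with_deriv_add p q ac_with_deriv_exp)
  qed (use \<kappa>0 in \<open>auto simp: y_def y1_def fun_eq_iff field_simps\<close>)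
  moreover have "ac_with_deriv y1 (\<lambda>x. -1 * (f x + z * y x))"
  proof (rule ac_with_deriv_cong)
    show "ac_with_deriv (\<lambda>x. 1 / 2 * ((-1 * p x + q x) + d * ?E x))
      (\<lambda>x. 1 / 2 * ((-1 * (- \<kappa> * p x + f x) + (\<kappa> * q x - f x)) + d * (- \<kappa> * ?E x)))"
      by (intro ac_with_deriv_cmult ac_with_deriv_add p q ac_with_deriv_exp)
    have "z = - (\<kappa> * \<kappa>)" using sq by simp
    then show "(\<lambda>x. 1 / 2 * ((-1 * (- \<kappa> * p x + f x) + (\<kappa> * q x - f x)) + d * (- \<kappa> * ?E x)))
        = (\<lambda>x. -1 * (f x + z * y x))"
      using \<kappa>0 by (auto simp: y_def fun_eq_iff field_simps)
  qed (simp add: y1_def fun_eq_iff)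
  ultimately have "W22_with_derivs y y1 (\<lambda>x. -1 * (f x + z * y x))"
    using y L2_pos_cmult[OF fy, of "-1"] by (simp add: W22_with_derivs_def)
  then have "(y, \<lambda>x. f x + z * y x) \<in> L_free"
    by (rule L_freeI[OF y(1) fy]) (simp_all add: y_def d_def)
  then show ?thesis by blast
qed

lemma L2_pos_diff: "f \<in> L2_pos \<Longrightarrow> g \<in> L2_pos \<Longrightarrow> (\<lambda>x. f x - g x) \<in> L2_pos"
  using L2_pos_add[of f "\<lambda>x. -1 * g x"] L2_pos_cmult[of g "-1"] by simp

lemma L_free_zero: "(\<lambda>x. 0, \<lambda>x. 0) \<in> L_free"
  by (rule L_freeI[where u = "\<lambda>x. 0" and ?u1.0 = "\<lambda>x. 0" and ?u2.0 = "\<lambda>x. 0"])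
    (auto simp: W22_with_derivs_def L2_pos_zero ac_with_deriv_const)

lemma L_free_sum:
  "(\<And>i. i \<in> I \<Longrightarrow> (y i, f i) \<in> L_free) \<Longrightarrow> (\<lambda>x. \<Sum>i\<in>I. y i x, \<lambda>x. \<Sum>i\<in>I. f i x) \<in> L_free"
  by (induction I rule: infinite_finite_induct) (auto intro: L_free_zero L_free_add)

subsection \<open>Finite rank perturbations\<close>

lemma L_pert_0: "L_pert \<alpha> v 0 = L_free"
proof -
  have "(y, g) \<in> L_pert \<alpha> v 0 \<longleftrightarrow> (y, g) \<in> L_free" for y g
  proof
    assume "(y, g) \<in> L_pert \<alpha> v 0"
    then obtain f where "(y, f) \<in> L_free" "g \<in> L2_pos" "AE x in pos_measure. g x = f x"
      by (auto simp: L_pert_def)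
    then show "(y, g) \<in> L_free"
      by (rule L_free_cong_AE)
  next
    assume "(y, g) \<in> L_free"
    then show "(y, g) \<in> L_pert \<alpha> v 0"
      using L_freeD(2) by (auto simp: L_pert_def)
  qed
  then show ?thesis by auto
qed

definition rank_sum ::
    "(nat \<Rightarrow> real) \<Rightarrow> (nat \<Rightarrow> real \<Rightarrow> complex) \<Rightarrow> nat \<Rightarrow> (real \<Rightarrow> complex) \<Rightarrow> real \<Rightarrow> complex" where
  "rank_sum \<alpha> v k y x = (\<Sum>s=1..k. complex_of_real (\<alpha> s) * L2_inner y (v s) * v s x)"

lemma rank_sum_L2_pos:
  "(\<And>s. s \<in> {1..k} \<Longrightarrow> v s \<in> L2_pos) \<Longrightarrow> rank_sum \<alpha> v k y \<in> L2_pos"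
  unfolding rank_sum_def by (intro L2_pos_sum L2_pos_cmult)

lemma rank_sum_linear:
  assumes "\<And>s. s \<in> {1..k} \<Longrightarrow> v s \<in> L2_pos" "y \<in> L2_pos" "w \<in> L2_pos"
  shows "rank_sum \<alpha> v k (\<lambda>x. y x + c * w x) x = rank_sum \<alpha> v k y x + c * rank_sum \<alpha> v k w x"
proof -
  have "L2_inner (\<lambda>x. y x + c * w x) (v s) = L2_inner y (v s) + c * L2_inner w (v s)"
    if "s \<in> {1..k}" for s
    using assms that by (simp add: L2_inner_add_left L2_inner_cmult_left L2_pos_cmult)
  then show ?thesis
    by (simp add: rank_sum_def sum_distrib_left sum.distrib[symmetric] algebra_simps)
qed

text \<open>Moving the perturbation to the right-hand side turns the resolvent equation for L_k into
  membership in the free graph, where sums and multiples are available.\<close>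

lemma L_pert_resolvent_equation:
  assumes v: "\<And>s. s \<in> {1..k} \<Longrightarrow> v s \<in> L2_pos" and f: "f \<in> L2_pos"
  shows "(\<exists>g. (y, g) \<in> L_pert \<alpha> v k \<and> (AE x in pos_measure. g x - z * y x = f x)) \<longleftrightarrow>
    (y, \<lambda>x. f x - rank_sum \<alpha> v k y x + z * y x) \<in> L_free" (is "?L \<longleftrightarrow> ?R")
proof
  assume ?L
  then obtain g h where h: "(y, h) \<in> L_free"
    and gh: "AE x in pos_measure. g x = h x + rank_sum \<alpha> v k y x"
    and gf: "AE x in pos_measure. g x - z * y x = f x"
    by (auto simp: L_pert_def rank_sum_def)
  show ?R
  proof (rule L_free_cong_AE[OF h])
    show "(\<lambda>x. f x - rank_sum \<alpha> v k y x + z * y x) \<in> L2_pos"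
      using L_freeD(1)[OF h] rank_sum_L2_pos[OF v] f
      by (intro L2_pos_add L2_pos_diff L2_pos_cmult) auto
    show "AE x in pos_measure. f x - rank_sum \<alpha> v k y x + z * y x = h x"
      using gh gf by eventually_elim (simp add: algebra_simps)
  qed
next
  assume R: ?R
  have "(y, \<lambda>x. f x + z * y x) \<in> L_pert \<alpha> v k"
    unfolding L_pert_def
  proof (intro CollectI case_prodI conjI exI[of _ "\<lambda>x. f x - rank_sum \<alpha> v k y x + z * y x"] R)
    show "(\<lambda>x. f x + z * y x) \<in> L2_pos"
      using L_freeD(1)[OF R] f by (intro L2_pos_add L2_pos_cmult)
  qed (simp add: rank_sum_def)
  then show ?L
    by (intro exI[of _ "\<lambda>x. f x + z * y x"]) simp
qed

text \<open>The hypothesis \<open>y\<close> says that L_k y = z y. Pair it with y: the free form is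
  real, and so is the perturbation term, the sum of \<alpha>_s |<y, v_s>|^2. Hence Im z times the
  squared norm of y vanishes.\<close>

lemma L_pert_no_eigenvalue:
  assumes v: "\<And>s. s \<in> {1..k} \<Longrightarrow> v s \<in> L2_pos" and z: "z \<notin> \<real>"
    and y: "(y, \<lambda>x. z * y x - rank_sum \<alpha> v k y x) \<in> L_free"
  shows "AE x in pos_measure. y x = 0"
proof -
  note yL2 = L_freeD(1)[OF y]
  define r where "r = rank_sum \<alpha> v k y"
  have r: "r \<in> L2_pos"
    unfolding r_def using v by (rule rank_sum_L2_pos)
  have "L2_inner r y = (\<Sum>s=1..k. complex_of_real (\<alpha> s) * L2_inner y (v s) * L2_inner (v s) y)"
    unfolding r_def rank_sum_def using v yL2
    by (subst L2_inner_sum_left) (auto simp: L2_inner_cmult_left intro: L2_pos_cmult)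
  also have "\<dots> = (\<Sum>s=1..k. complex_of_real (\<alpha> s * (cmod (L2_inner y (v s)))\<^sup>2))"
    by (intro sum.cong)
      (simp_all add: L2_inner_commute[of _ y] complex_norm_square mult.assoc del: of_real_power)
  finally have "L2_inner r y \<in> \<real>"
    by (simp del: of_real_mult)
  moreover have "L2_inner (\<lambda>x. z * y x + -1 * r x) y \<in> \<real>"
    using L_free_inner_real[OF y] by (simp add: r_def)
  then have "z * L2_inner y y + -1 * L2_inner r y \<in> \<real>"
    using L2_inner_add_left[OF L2_pos_cmult[OF yL2, of z] L2_pos_cmult[OF r, of "-1"] yL2]
    by (simp only: L2_inner_cmult_left)
  ultimately have "z * L2_inner y y \<in> \<real>"
    using Reals_add by fastforce
  then have "Im z * Re (L2_inner y y) = 0"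
    by (simp add: complex_is_Real_iff L2_inner_self)
  then have "L2_inner y y = 0"
    using z by (simp add: complex_is_Real_iff L2_inner_self)
  then show ?thesis
    using yL2 by (intro L2_inner_self_eq_0)
qed

lemma L2_inner_AE_zero:
  "y \<in> L2_pos \<Longrightarrow> h \<in> L2_pos \<Longrightarrow> AE x in pos_measure. y x = 0 \<Longrightarrow> L2_inner y h = 0"
  using L2_inner_cong_AE[of y "\<lambda>x. 0" h h] by (auto simp: L2_inner_def dest: L2_posD)

text \<open>Induction on the rank. A solution for rank k + 1 is sought as y + t w, where y and w
  solve the rank k equation with right-hand sides f and v_(k+1).\<close>

lemma L_pert_solvable:
  assumes "\<And>s. s \<in> {1..k} \<Longrightarrow> v s \<in> L2_pos" and z: "z \<notin> \<real>" and "f \<in> L2_pos"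
  shows "\<exists>y. (y, \<lambda>x. f x - rank_sum \<alpha> v k y x + z * y x) \<in> L_free"
  using assms(1,3)
proof (induction k arbitrary: f)
  case 0
  then show ?case
    using L_free_solvable[OF _ z] by (simp add: rank_sum_def)
next
  case (Suc k)
  let ?u = "v (Suc k)" and ?a = "complex_of_real (\<alpha> (Suc k))"
  have v: "v s \<in> L2_pos" if "s \<in> {1..k}" for s
    using Suc.prems(1) that by simp
  have u: "?u \<in> L2_pos"
    using Suc.prems(1) by simp
  have rank_Suc: "rank_sum \<alpha> v (Suc k) y x = rank_sum \<alpha> v k y x + ?a * L2_inner y ?u * ?u x" for y x
    by (simp add: rank_sum_def)
  obtain w where w: "(w, \<lambda>x. ?u x - rank_sum \<alpha> v k w x + z * w x) \<in> L_free"
    using Suc.IH[OF v u] by blast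
  obtain y where y: "(y, \<lambda>x. f x - rank_sum \<alpha> v k y x + z * y x) \<in> L_free"
    using Suc.IH[OF v Suc.prems(2)] by blast
  note wL2 = L_freeD(1)[OF w] and yL2 = L_freeD(1)[OF y]
  define b where "b = 1 + ?a * L2_inner w ?u"
  have "b \<noteq> 0"
  proof
    \<comment> \<open>If b = 0, the source term in the equation for \<open>w\<close> is exactly the
      new rank-one term, so \<open>w\<close> would be an eigenvector of L_(k+1). It then vanishes
      almost everywhere, which gives b = 1.\<close>
    assume b0: "b = 0"
    then have a: "?a * L2_inner w ?u = -1"
      by (simp add: b_def add_eq_0_iff)
    have "(w, \<lambda>x. z * w x - rank_sum \<alpha> v (Suc k) w x) \<in> L_free"
      using w unfolding rank_Suc a by (simp add: algebra_simps)
    then have "AE x in pos_measure. w x = 0"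
      using Suc.prems(1) z by (intro L_pert_no_eigenvalue)
    then have "L2_inner w ?u = 0"
      using wL2 u by (intro L2_inner_AE_zero)
    then show False
      using b0 by (simp add: b_def)
  qed
  \<comment> \<open>The new rank-one term applied to \<open>y'\<close> must absorb the source t
    v_(k+1), which means a <y', v_(k+1)> = -t, with a the new coefficient. Since <y', v_(k+1)> is
    affine in t, this reads t b = -a <y, v_(k+1)>.\<close>
  define t where "t = - (?a * L2_inner y ?u / b)"
  define y' where "y' x = y x + t * w x" for x
  have inner: "?a * L2_inner y' ?u = - t"
  proof -
    have "?a * L2_inner y' ?u = ?a * L2_inner y ?u + t * (b - 1)"
      using yL2 wL2 u
      by (simp add: y'_def[abs_def] L2_inner_add_left L2_inner_cmult_left L2_pos_cmult b_def algebra_simps)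
    also have "\<dots> = - t"
      using \<open>b \<noteq> 0\<close> by (simp add: t_def field_simps)
    finally show ?thesis .
  qed
  have "(\<lambda>x. y x + t * w x, \<lambda>x. (f x - rank_sum \<alpha> v k y x + z * y x)
      + t * (?u x - rank_sum \<alpha> v k w x + z * w x)) \<in> L_free"
    by (intro L_free_add L_free_cmult y w)
  moreover have "(f x - rank_sum \<alpha> v k y x + z * y x) + t * (?u x - rank_sum \<alpha> v k w x + z * w x)
      = f x - rank_sum \<alpha> v (Suc k) y' x + z * y' x" for x
    unfolding rank_Suc inner
    using rank_sum_linear[OF v yL2 wL2, where \<alpha> = \<alpha> and c = t and x = x]
    by (simp add: y'_def[abs_def] algebra_simps)
  ultimately show ?case
    by (auto simp: y'_def[abs_def])
qed

section \<open>Resolvents and the second resolvent identity\<close>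

lemma resolvent_L_pert:
  fixes \<alpha> :: "nat \<Rightarrow> real"
  assumes v: "\<And>s. s \<in> {1..k} \<Longrightarrow> v s \<in> L2_pos" and z: "z \<notin> \<real>" and f: "f \<in> L2_pos"
  defines "y \<equiv> resolvent (L_pert \<alpha> v k) z f"
  shows "(y, \<lambda>x. f x - rank_sum \<alpha> v k y x + z * y x) \<in> L_free"
proof -
  have "\<exists>y. (y, \<lambda>x. f x - rank_sum \<alpha> v k y x + z * y x) \<in> L_free"
    using v z f by (rule L_pert_solvable)
  then have "\<exists>y. \<exists>g. (y, g) \<in> L_pert \<alpha> v k \<and> (AE x in pos_measure. g x - z * y x = f x)"
    using L_pert_resolvent_equation[where k = k and v = v, OF v f] by blast
  from someI_ex[OF this] show ?thesis
    unfolding y_def resolvent_def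
    using L_pert_resolvent_equation[where k = k and v = v, OF v f] by blast
qed

lemma resolvent_L_free:
  assumes "z \<notin> \<real>" "f \<in> L2_pos"
  shows "(resolvent L_free z f, \<lambda>x. f x + z * resolvent L_free z f x) \<in> L_free"
  using resolvent_L_pert[of 0 _ z f] assms by (simp add: L_pert_0 rank_sum_def)

text \<open>The second resolvent identity holds only almost everywhere, since resolvents are chosen
  representatives; paired with \<open>h\<close> it becomes an equation of numbers.\<close>

lemma resolvent_L_pert_inner:
  fixes \<alpha> :: "nat \<Rightarrow> real"
  assumes v: "\<And>s. s \<in> {1..k} \<Longrightarrow> v s \<in> L2_pos" and z: "z \<notin> \<real>" and f: "f \<in> L2_pos"
    and h: "h \<in> L2_pos"
  defines "y \<equiv> resolvent (L_pert \<alpha> v k) z f"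
  shows "L2_inner (resolvent L_free z f) h = L2_inner y h
    + (\<Sum>s=1..k. complex_of_real (\<alpha> s) * L2_inner y (v s) * L2_inner (resolvent L_free z (v s)) h)"
proof -
  define c where "c s = complex_of_real (\<alpha> s) * L2_inner y (v s)" for s
  let ?R = "\<lambda>f. resolvent L_free z f"
  have y: "(y, \<lambda>x. f x - rank_sum \<alpha> v k y x + z * y x) \<in> L_free"
    unfolding y_def using v z f by (rule resolvent_L_pert)
  note yL2 = L_freeD(1)[OF y]
  have RL2: "?R g \<in> L2_pos" if "g \<in> L2_pos" for g
    using resolvent_L_free[OF z that] by (rule L_freeD)
  define s where "s x = (\<Sum>s=1..k. c s * ?R (v s) x)" for x
  have sL2: "s \<in> L2_pos"
    unfolding s_def using v by (intro L2_pos_sum L2_pos_cmult RL2)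
  \<comment> \<open>The difference of the two sides of the identity solves the homogeneous free
    equation, so it vanishes almost everywhere.\<close>
  define d where "d x = ?R f x + -1 * (y x + s x)" for x
  have "(\<lambda>x. ?R f x + -1 * (y x + s x), \<lambda>x. (f x + z * ?R f x)
      + -1 * ((f x - rank_sum \<alpha> v k y x + z * y x) + (\<Sum>s=1..k. c s * (v s x + z * ?R (v s) x)))) \<in> L_free"
    unfolding s_def using v
    by (intro L_free_add L_free_cmult L_free_sum y resolvent_L_free z f)
  \<comment> \<open>The rank-zero sum is 0; it is displayed so that the eigenvalue lemma applies
    with k = 0.\<close>
  moreover have "(f x + z * ?R f x)
      + -1 * ((f x - rank_sum \<alpha> v k y x + z * y x) + (\<Sum>s=1..k. c s * (v s x + z * ?R (v s) x)))
      = z * d x - rank_sum \<alpha> v 0 d x" for x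
    by (simp add: rank_sum_def d_def s_def c_def sum.distrib sum_distrib_left algebra_simps)
  ultimately have "(d, \<lambda>x. z * d x - rank_sum \<alpha> v 0 d x) \<in> L_free"
    by (simp add: d_def[abs_def])
  then have "AE x in pos_measure. d x = 0"
    by (rule L_pert_no_eigenvalue[OF _ z, rotated]) simp
  moreover have dL2: "d \<in> L2_pos"
    unfolding d_def by (intro L2_pos_add L2_pos_cmult RL2 f yL2 sL2)
  ultimately have "L2_inner d h = 0"
    using h by (intro L2_inner_AE_zero)
  moreover have "L2_inner d h = L2_inner (?R f) h + -1 * (L2_inner y h + L2_inner s h)"
    unfolding d_def[abs_def] using RL2[OF f] yL2 sL2 h
    by (simp only: L2_inner_add_left L2_inner_cmult_left L2_pos_add L2_pos_cmult)
  ultimately have "L2_inner (?R f) h + -1 * (L2_inner y h + L2_inner s h) = 0"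
    by (simp only:)
  then have "L2_inner (?R f) h = L2_inner y h + L2_inner s h"
    by (simp only: mult_minus1 add_uminus_conv_diff right_minus_eq)
  moreover have "L2_inner s h = (\<Sum>s=1..k. c s * L2_inner (?R (v s)) h)"
    unfolding s_def[abs_def] using v h RL2
    by (subst L2_inner_sum_left) (auto simp: L2_inner_cmult_left intro: L2_pos_cmult)
  ultimately show ?thesis
    by (simp add: c_def)
qed

subsection \<open>The determinant\<close>

text \<open>The matrix is the product of a block lower triangular matrix, with last column b times
  the last unit vector, and a unipotent matrix that adds the combination of the other
  columns.\<close>

lemma det_last_column_combination:
  fixes g :: "nat \<Rightarrow> nat \<Rightarrow> 'a :: idom"
  assumes "\<And>r. r \<le> m \<Longrightarrow> g r m = (if r = m then b else 0) + (\<Sum>s<m. g r s * d s)"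
  shows "Determinant.det (Matrix.mat (Suc m) (Suc m) (\<lambda>(r, s). g r s))
    = Determinant.det (Matrix.mat m m (\<lambda>(r, s). g r s)) * b"
proof -
  let ?A = "Matrix.mat m m (\<lambda>(r, s). g r s)"
  let ?C = "Matrix.mat 1 m (\<lambda>(r, s). g m s)"
  let ?B = "Matrix.mat 1 1 (\<lambda>_. b)"
  let ?D = "Matrix.mat m 1 (\<lambda>(r, s). d r)"
  let ?N = "four_block_mat ?A (0\<^sub>m m 1) ?C ?B"
  let ?U = "four_block_mat (1\<^sub>m m) ?D (0\<^sub>m 1 m) (1\<^sub>m 1)"
  have "?N * ?U = four_block_mat (?A * 1\<^sub>m m + 0\<^sub>m m 1 * 0\<^sub>m 1 m) (?A * ?D + 0\<^sub>m m 1 * 1\<^sub>m 1)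
      (?C * 1\<^sub>m m + ?B * 0\<^sub>m 1 m) (?C * ?D + ?B * 1\<^sub>m 1)"
    by (rule mult_four_block_mat) auto
  also have "\<dots> = Matrix.mat (Suc m) (Suc m) (\<lambda>(r, s). g r s)"
    using assms by (intro eq_matI)
      (auto simp: scalar_prod_def lessThan_atLeast0 less_Suc_eq)
  finally have "Matrix.mat (Suc m) (Suc m) (\<lambda>(r, s). g r s) = ?N * ?U" ..
  moreover have "?N \<in> carrier_mat (m + 1) (m + 1)" "?U \<in> carrier_mat (m + 1) (m + 1)"
    by (auto intro!: four_block_carrier_mat)
  moreover have "Determinant.det ?N = Determinant.det ?A * Determinant.det ?B"
    by (rule det_four_block_mat_upper_right_zero[where n = m and m = 1]) auto
  moreover have "Determinant.det ?U = Determinant.det (1\<^sub>m m) * Determinant.det (1\<^sub>m 1)"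
    by (rule det_four_block_mat_lower_left_zero[where n = m and m = 1]) auto
  ultimately show ?thesis
    by (simp add: det_mult det_single)
qed

text \<open>In this form the entries do not depend on \<open>n\<close>, so \<open>b_det m\<close> is
  visibly a leading principal minor of \<open>b_det (Suc m)\<close>.\<close>

lemma b_det_eq:
  "b_det n \<alpha> v z = Determinant.det (Matrix.mat n n (\<lambda>(r, s). (if r = s then 1 else 0)
    + complex_of_real (\<alpha> (Suc r)) * L2_inner (resolvent L_free z (v (Suc s))) (v (Suc r))))"
proof -
  have "alpha_mat n \<alpha> * T_mat n v z = Matrix.mat n n (\<lambda>(r, s).
      complex_of_real (\<alpha> (Suc r)) * L2_inner (resolvent L_free z (v (Suc s))) (v (Suc r)))"
    unfolding alpha_mat_def T_mat_def by (subst mat_diag_mult_left[of _ n n]) auto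
  then show ?thesis
    unfolding b_det_def by (intro arg_cong[of _ _ Determinant.det] eq_matI) auto
qed

lemma b_det_Suc:
  assumes v: "\<And>k. k \<in> {1..Suc m} \<Longrightarrow> v k \<in> L2_pos" and z: "z \<notin> \<real>"
  shows "b_det (Suc m) \<alpha> v z = b_det m \<alpha> v z * b_factor \<alpha> v (Suc m) z"
proof -
  let ?a = "\<lambda>r. complex_of_real (\<alpha> (Suc r))"
  let ?T = "\<lambda>r s. L2_inner (resolvent L_free z (v (Suc s))) (v (Suc r))"
  define c where "c r = L2_inner (resolvent (L_pert \<alpha> v m) z (v (Suc m))) (v (Suc r))" for r
  have T: "?T r m = c r + (\<Sum>s<m. ?a s * c s * ?T r s)" if "r \<le> m" for r
  proof -
    have "?T r m = c r + (\<Sum>s=1..m. complex_of_real (\<alpha> s)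
        * L2_inner (resolvent (L_pert \<alpha> v m) z (v (Suc m))) (v s)
        * L2_inner (resolvent L_free z (v s)) (v (Suc r)))"
      unfolding c_def using v that z by (intro resolvent_L_pert_inner) auto
    then show ?thesis
      by (simp add: c_def sum.atLeast1_atMost_eq)
  qed
  have "b_det (Suc m) \<alpha> v z = b_det m \<alpha> v z * (1 + ?a m * c m)"
    unfolding b_det_eq
  \<comment> \<open>The coefficients are those of the resolvent identity \<open>T\<close>, in which
    \<alpha>_s <w, v_s> multiplies column s, with w the vector R_m(z) v_(m+1).\<close>
  proof (rule det_last_column_combination[where d = "\<lambda>s. ?a s * c s"])
    fix r
    assume r: "r \<le> m"
    have "((if r = s then 1 else 0) + ?a r * ?T r s) * (?a s * c s)
        = (if r = s then ?a s * c s else 0) + ?a r * (?a s * c s * ?T r s)" for s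
      by (simp add: algebra_simps)
    then have "(\<Sum>s<m. ((if r = s then 1 else 0) + ?a r * ?T r s) * (?a s * c s))
        = (\<Sum>s<m. (if r = s then ?a s * c s else 0)) + ?a r * (\<Sum>s<m. ?a s * c s * ?T r s)"
      by (simp only: sum.distrib sum_distrib_left)
    \<comment> \<open>For r < m the diagonal entry restores the summand \<open>c r\<close> missing
      from the identity \<open>T\<close>. In the last row no s < m matches, and the leftover is
      \<open>1 + ?a m * c m\<close>.\<close>
    also have "(\<Sum>s<m. (if r = s then ?a s * c s else 0)) = (if r = m then 0 else ?a r * c r)"
      using r by (simp add: sum.delta')
    finally show "(if r = m then 1 else 0) + ?a r * ?T r m = (if r = m then 1 + ?a m * c m else 0)
        + (\<Sum>s<m. ((if r = s then 1 else 0) + ?a r * ?T r s) * (?a s * c s))"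
      by (simp add: T[OF r] distrib_left)
  qed
  then show ?thesis
    by (simp add: b_factor_def c_def)
qed

theorem theorem3p2:
  fixes n :: nat and \<alpha> :: "nat \<Rightarrow> real" and v :: "nat \<Rightarrow> real \<Rightarrow> complex" and z :: complex
  assumes "\<And>k. k \<in> {1..n} \<Longrightarrow> \<alpha> k \<noteq> 0"
    and "\<And>k. k \<in> {1..n} \<Longrightarrow> v k \<in> borel_measurable pos_measure"
    and "\<And>k. k \<in> {1..n} \<Longrightarrow> integrable pos_measure (\<lambda>x. (1 + x\<^sup>2) * (cmod (v k x))\<^sup>2)"
    and "L2_independent n v"
    and "z \<notin> \<real>"
  shows "b_det n \<alpha> v z = (\<Prod>k=1..n. b_factor \<alpha> v k z)"
proof -
  have v: "v k \<in> L2_pos" if "k \<in> {1..n}" for k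
  proof -
    \<comment> \<open>The weight 1 + x^2 is at least 1.\<close>
    have "integrable pos_measure (\<lambda>x. (cmod (v k x))\<^sup>2)"
    proof (rule Bochner_Integration.integrable_bound[OF assms(3)[OF that]])
      show "(\<lambda>x. (cmod (v k x))\<^sup>2) \<in> borel_measurable pos_measure"
        using assms(2)[OF that] by simp
      show "AE x in pos_measure. norm ((cmod (v k x))\<^sup>2) \<le> norm ((1 + x\<^sup>2) * (cmod (v k x))\<^sup>2)"
        by (simp add: abs_mult mult_le_cancel_right1)
    qed
    then show ?thesis
      using assms(2)[OF that] by (simp add: L2_pos_def)
  qed
  \<comment> \<open>The induction runs over the leading minors, starting from the empty determinant
    1.\<close>
  have "b_det m \<alpha> v z = (\<Prod>k=1..m. b_factor \<alpha> v k z)" if "m \<le> n" for m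
    using that
  proof (induction m)
    case 0
    then show ?case
      by (simp add: b_det_eq)
  next
    case (Suc m)
    have "b_det (Suc m) \<alpha> v z = b_det m \<alpha> v z * b_factor \<alpha> v (Suc m) z"
      by (rule b_det_Suc) (use v assms(5) Suc.prems in auto)
    then show ?case
      using Suc by simp
  qed
  then show ?thesis by simp
qed

end
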